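(* Let $\rho_A$ be a state of $A$ and $\sigma_B$ a state of $B$. There exists a $G$-covariant quantum channel $\mathcal{E}$ from $A$ to $B$ with $\mathcal{E}(\rho)=\sigma$ if and only if the function $\eta\mapsto\Delta H_\eta$, defined on the state space of $R$, has a local minimum at the maximally mixed state $\eta=\mathbb{1}/d_R$.
   Context: $G$ is a compact group with normalized Haar measure $dg$. Finite-dimensional systems $A,B$ carry continuous unitary representations $U_A(g),U_B(g)$. The reference $R$ has $d_R=d_B$ and carries the dual representation $U_R(g)=\overline{U_B(g)}$. A channel $\mathcal{E}$ from $A$ to $B$ is $G$-covariant if $\mathcal{E}(U_A(g)XU_A(g)^\dagger)=U_B(g)\mathcal{E}(X)U_B(g)^\dagger$ for all $g,X$. The $G$-twirl on $RX$ ($X=A,B$) is $\mathcal{G}(M)=\int dg\,(U_R(g)\otimes U_X(g))M(U_R(g)\otimes U_X(g))^\dagger$. $H_{\min}(R|X)_\Omega=-\log_2\inf_{Y\ge0}\{\mathrm{tr}[Y]:\mathbb{1}_R\otimes Y\ge\Omega_{RX}\}$. For a state $\eta$ of $R$ and a state $\tau$ of $X$, $H_\eta(\tau):=H_{\min}(R|X)_{\mathcal{G}(\eta\otimes\tau)}$, and $\Delta H_\eta:=H_\eta(\sigma)-H_\eta(\rho)$. Local minimum refers to the topology of the state space of $R$. *)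

theory Defs
  imports "HOL-Analysis.Analysis" "Jordan_Normal_Form.Matrix"
begin

definition mtrace :: "complex mat \<Rightarrow> complex" where
  "mtrace M = (\<Sum>i<dim_row M. M $$ (i,i))"

definition dagger :: "complex mat \<Rightarrow> complex mat" where
  "dagger M = mat (dim_col M) (dim_row M) (\<lambda>(i,j). cnj (M $$ (j,i)))"

definition cconj_mat :: "complex mat \<Rightarrow> complex mat" where
  "cconj_mat M = map_mat cnj M"

definition kron :: "complex mat \<Rightarrow> complex mat \<Rightarrow> complex mat" where
  "kron A B = mat (dim_row A * dim_row B) (dim_col A * dim_col B)
     (\<lambda>(i,j). A $$ (i div dim_row B, j div dim_col B) * B $$ (i mod dim_row B, j mod dim_col B))"

definition psd :: "nat \<Rightarrow> complex mat \<Rightarrow> bool" where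
  "psd n M \<longleftrightarrow> M \<in> carrier_mat n n \<and>
     (\<forall>v \<in> carrier_vec n. Im (conjugate v \<bullet> (M *\<^sub>v v)) = 0 \<and> Re (conjugate v \<bullet> (M *\<^sub>v v)) \<ge> 0)"

definition density :: "nat \<Rightarrow> complex mat \<Rightarrow> bool" where
  "density n \<rho> \<longleftrightarrow> psd n \<rho> \<and> mtrace \<rho> = 1"

definition unitary :: "nat \<Rightarrow> complex mat \<Rightarrow> bool" where
  "unitary n U \<longleftrightarrow> U \<in> carrier_mat n n \<and> U * dagger U = 1\<^sub>m n"

definition blk :: "nat \<Rightarrow> complex mat \<Rightarrow> nat \<Rightarrow> nat \<Rightarrow> complex mat" where
  "blk d M a b = mat d d (\<lambda>(p,q). M $$ (a*d + p, b*d + q))"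

definition id_tensor :: "nat \<Rightarrow> nat \<Rightarrow> nat \<Rightarrow> (complex mat \<Rightarrow> complex mat) \<Rightarrow> complex mat \<Rightarrow> complex mat" where
  "id_tensor k dA dB E M = mat (k*dB) (k*dB)
     (\<lambda>(i,j). E (blk dA M (i div dB) (j div dB)) $$ (i mod dB, j mod dB))"

definition channel :: "nat \<Rightarrow> nat \<Rightarrow> (complex mat \<Rightarrow> complex mat) \<Rightarrow> bool" where
  "channel dA dB E \<longleftrightarrow>
     (\<forall>X \<in> carrier_mat dA dA. E X \<in> carrier_mat dB dB) \<and>
     (\<forall>X \<in> carrier_mat dA dA. \<forall>Y \<in> carrier_mat dA dA. E (X + Y) = E X + E Y) \<and>
     (\<forall>X \<in> carrier_mat dA dA. \<forall>c. E (c \<cdot>\<^sub>m X) = c \<cdot>\<^sub>m E X) \<and>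
     (\<forall>X \<in> carrier_mat dA dA. mtrace (E X) = mtrace X) \<and>
     (\<forall>k M. psd (k*dA) M \<longrightarrow> psd (k*dB) (id_tensor k dA dB E M))"

definition compact_group :: "('g::t2_space \<Rightarrow> 'g \<Rightarrow> 'g) \<Rightarrow> 'g \<Rightarrow> ('g \<Rightarrow> 'g) \<Rightarrow> bool" where
  "compact_group gmul e ginv \<longleftrightarrow>
     (\<forall>x y z. gmul (gmul x y) z = gmul x (gmul y z)) \<and>
     (\<forall>x. gmul e x = x) \<and> (\<forall>x. gmul (ginv x) x = e) \<and>
     continuous_on UNIV (\<lambda>p. gmul (fst p) (snd p)) \<and>
     continuous_on UNIV ginv \<and> compact (UNIV :: 'g set)"

definition haar :: "('g::topological_space \<Rightarrow> 'g \<Rightarrow> 'g) \<Rightarrow> 'g measure \<Rightarrow> bool" where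
  "haar gmul \<mu> \<longleftrightarrow> sets \<mu> = sets borel \<and> emeasure \<mu> (space \<mu>) = 1 \<and>
     (\<forall>g. \<forall>S \<in> sets borel. emeasure \<mu> (gmul g ` S) = emeasure \<mu> S)"

definition unitary_rep :: "('g::topological_space \<Rightarrow> 'g \<Rightarrow> 'g) \<Rightarrow> nat \<Rightarrow> ('g \<Rightarrow> complex mat) \<Rightarrow> bool" where
  "unitary_rep gmul d U \<longleftrightarrow>
     (\<forall>g. unitary d (U g)) \<and> (\<forall>g h. U (gmul g h) = U g * U h) \<and>
     (\<forall>i j. i < d \<longrightarrow> j < d \<longrightarrow> continuous_on UNIV (\<lambda>g. U g $$ (i,j)))"

definition covariant :: "nat \<Rightarrow> ('g \<Rightarrow> complex mat) \<Rightarrow> ('g \<Rightarrow> complex mat) \<Rightarrow> (complex mat \<Rightarrow> complex mat) \<Rightarrow> bool" where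
  "covariant dA UA UB E \<longleftrightarrow>
     (\<forall>g. \<forall>X \<in> carrier_mat dA dA. E (UA g * X * dagger (UA g)) = UB g * E X * dagger (UB g))"

definition twirl :: "'g measure \<Rightarrow> nat \<Rightarrow> ('g \<Rightarrow> complex mat) \<Rightarrow> complex mat \<Rightarrow> complex mat" where
  "twirl \<mu> n V M = mat n n (\<lambda>(i,j). \<integral>g. (V g * M * dagger (V g)) $$ (i,j) \<partial>\<mu>)"

definition hmin :: "nat \<Rightarrow> nat \<Rightarrow> complex mat \<Rightarrow> real" where
  "hmin dR dX \<Omega> = - log 2 (Inf {Re (mtrace Y) | Y. psd dX Y \<and> psd (dR*dX) (kron (1\<^sub>m dR) Y - \<Omega>)})"

definition Heta :: "'g measure \<Rightarrow> ('g \<Rightarrow> complex mat) \<Rightarrow> nat \<Rightarrow> ('g \<Rightarrow> complex mat) \<Rightarrow> nat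
                    \<Rightarrow> complex mat \<Rightarrow> complex mat \<Rightarrow> real" where
  "Heta \<mu> UR dR UX dX \<eta> \<tau> = hmin dR dX (twirl \<mu> (dR*dX) (\<lambda>g. kron (UR g) (UX g)) (kron \<eta> \<tau>))"

definition local_min_states :: "nat \<Rightarrow> (complex mat \<Rightarrow> real) \<Rightarrow> complex mat \<Rightarrow> bool" where
  "local_min_states d f \<eta>0 \<longleftrightarrow>
     (\<exists>\<epsilon>>0. \<forall>\<eta>. density d \<eta> \<and> (\<forall>i<d. \<forall>j<d. cmod (\<eta> $$ (i,j) - \<eta>0 $$ (i,j)) < \<epsilon>)
                 \<longrightarrow> f \<eta>0 \<le> f \<eta>)"

end

theory Submission
  imports Defs "Jordan_Normal_Form.Determinant"
begin

text \<open>Write \<open>m\<^sub>X(\<eta>) = 2 powr (- H\<^sub>\<eta>)\<close> for the optimal value of the semidefinite programme on the side of \<open>X\<close>.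
  Both values are \<open>1/d\<^sub>R\<close> at the maximally mixed state, so the local minimum condition says
  \<open>m\<^sub>B(\<eta>) \<le> m\<^sub>A(\<eta>)\<close> for all states \<open>\<eta>\<close> near \<open>1/d\<^sub>R\<close>.
  A covariant channel maps feasible points for \<open>\<rho>\<close> to feasible points for \<open>\<sigma>\<close> of the same trace, which gives
  this inequality for all \<open>\<eta>\<close>.
  Conversely, covariant channels correspond to invariant positive Choi matrices. If none of them
  sends \<open>\<rho>\<close> to \<open>\<sigma>\<close>, separating the compact convex set of invariant positive matrices of trace \<open>d\<^sub>A\<close> from the
  affine constraints (trace preservation and \<open>\<rho> \<mapsto> \<sigma>\<close>) yields Hermitian \<open>Y\<close> and \<open>H\<close> such that the twirl of
  \<open>1 \<otimes> Y - H \<otimes> \<rho>\<close> is positive while \<open>tr Y < \<Sum>\<^sub>a\<^sub>b H\<^sub>a\<^sub>b \<sigma>\<^sub>a\<^sub>b\<close>. For \<open>\<eta> = s 1 + \<epsilon> H\<close> this bounds \<open>m\<^sub>A(\<eta>)\<close> strictly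
  below \<open>\<Sum>\<^sub>a\<^sub>b \<eta>\<^sub>a\<^sub>b \<sigma>\<^sub>a\<^sub>b\<close>, and testing feasibility on the maximally entangled vector shows that the latter is at most
  \<open>m\<^sub>B(\<eta>)\<close>.\<close>

section \<open>Positive semidefinite forms\<close>

definition sesq :: "nat \<Rightarrow> (nat \<times> nat \<Rightarrow> complex) \<Rightarrow> (nat \<Rightarrow> complex) \<Rightarrow> (nat \<Rightarrow> complex) \<Rightarrow> complex" where
  "sesq n F x y = (\<Sum>i<n. \<Sum>j<n. cnj (x i) * F (i,j) * y j)"

definition psd_fun :: "nat \<Rightarrow> (nat \<times> nat \<Rightarrow> complex) \<Rightarrow> bool" where
  "psd_fun n F \<longleftrightarrow> (\<forall>x. 0 \<le> sesq n F x x)"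

lemma sesq_vec:
  assumes "M \<in> carrier_mat n n" "v \<in> carrier_vec n"
  shows "conjugate v \<bullet> (M *\<^sub>v v) = sesq n (($$) M) (($) v) (($) v)"
  using assms
  by (auto simp: sesq_def scalar_prod_def atLeast0LessThan sum_distrib_left mult.assoc intro!: sum.cong)

lemma sesq_cong:
  assumes "\<And>i j. i < n \<Longrightarrow> j < n \<Longrightarrow> F (i,j) = G (i,j)" "\<And>i. i < n \<Longrightarrow> x i = x' i" "\<And>i. i < n \<Longrightarrow> y i = y' i"
  shows "sesq n F x y = sesq n G x' y'"
  unfolding sesq_def using assms by (intro sum.cong) auto

lemma psd_iff: "psd n M \<longleftrightarrow> M \<in> carrier_mat n n \<and> psd_fun n (($$) M)"
proof (cases "M \<in> carrier_mat n n")
  case True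
  have "psd_fun n (($$) M)" if "psd n M"
    unfolding psd_fun_def
  proof
    fix x
    have "0 \<le> conjugate (vec n x) \<bullet> (M *\<^sub>v vec n x)"
      using that by (auto simp: psd_def less_eq_complex_def)
    also have "\<dots> = sesq n (($$) M) x x"
      unfolding sesq_vec[OF True vec_carrier] by (rule sesq_cong) auto
    finally show "0 \<le> sesq n (($$) M) x x" .
  qed
  moreover have "psd n M" if "psd_fun n (($$) M)"
    using that True by (auto simp: psd_def sesq_vec psd_fun_def less_eq_complex_def)
  ultimately show ?thesis using True by blast
qed (auto simp: psd_def)

lemma psd_fun_cong:
  assumes "\<And>i j. i < n \<Longrightarrow> j < n \<Longrightarrow> F (i,j) = G (i,j)"
  shows "psd_fun n F \<longleftrightarrow> psd_fun n G"
proof -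
  have "sesq n F x x = sesq n G x x" for x
    by (rule sesq_cong) (use assms in auto)
  thus ?thesis by (simp add: psd_fun_def)
qed

lemma sesq_expand:
  "sesq n F (\<lambda>i. x i + k * y i) (\<lambda>i. x i + k * y i)
    = sesq n F x x + k * sesq n F x y + cnj k * sesq n F y x + cnj k * k * sesq n F y y"
  unfolding sesq_def by (simp add: algebra_simps sum.distrib sum_distrib_left)

lemma sesq_cnj:
  assumes "psd_fun n F"
  shows "sesq n F y x = cnj (sesq n F x y)"
proof -
  have *: "Im (k * sesq n F x y + cnj k * sesq n F y x) = 0" if "cnj k * k = 1" for k
  proof -
    have "0 \<le> sesq n F x x" "0 \<le> sesq n F y y"
      "0 \<le> sesq n F (\<lambda>i. x i + k * y i) (\<lambda>i. x i + k * y i)"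
      using assms unfolding psd_fun_def by blast+
    thus ?thesis unfolding sesq_expand that by (simp add: less_eq_complex_def)
  qed
  from *[of 1] *[of \<i>] show ?thesis by (simp add: complex_eq_iff)
qed

lemma sesq_unit_left:
  assumes "a < n"
  shows "sesq n F (\<lambda>i. if i = a then 1 else 0) x = (\<Sum>j<n. F (a,j) * x j)"
proof -
  have "sesq n F (\<lambda>i. if i = a then 1 else 0) x
     = (\<Sum>i<n. if i = a then (\<Sum>j<n. F (i,j) * x j) else 0)"
    unfolding sesq_def by (intro sum.cong refl) auto
  thus ?thesis using assms by simp
qed

lemma sesq_unit:
  assumes "a < n" "b < n"
  shows "sesq n F (\<lambda>i. if i = a then 1 else 0) (\<lambda>i. if i = b then 1 else 0) = F (a,b)"
  using assms by (simp add: sesq_unit_left if_distrib[of "(*) _"] cong: if_cong)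

lemma psd_fun_hermitian:
  assumes "psd_fun n F" "i < n" "j < n"
  shows "F (j,i) = cnj (F (i,j))"
  using sesq_cnj[OF assms(1)] sesq_unit[OF assms(2,3)] sesq_unit[OF assms(3,2)] by metis

lemma sesq_CS:
  assumes "psd_fun n F"
  shows "(cmod (sesq n F x y))\<^sup>2 \<le> Re (sesq n F x x) * Re (sesq n F y y)"
proof -
  define a b s where "a = Re (sesq n F x x)" "b = Re (sesq n F y y)" "s = sesq n F x y"
  have pos: "0 \<le> sesq n F z z" for z using assms unfolding psd_fun_def by blast
  have a: "sesq n F x x = of_real a" and b: "sesq n F y y = of_real b" and ab0: "a \<ge> 0" "b \<ge> 0"
    using pos[of x] pos[of y] by (auto simp: a_b_s_def less_eq_complex_def complex_eq_iff)
  have key: "0 \<le> a + 2 * t * (cmod s)\<^sup>2 + t\<^sup>2 * (cmod s)\<^sup>2 * b" for t :: real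
  proof -
    let ?k = "of_real t * cnj s"
    have "0 \<le> sesq n F x x + ?k * sesq n F x y + cnj ?k * sesq n F y x + cnj ?k * ?k * sesq n F y y"
      using pos[of "\<lambda>i. x i + ?k * y i"] unfolding sesq_expand .
    also have "\<dots> = of_real a + 2 * of_real t * (s * cnj s) + (of_real t)\<^sup>2 * (s * cnj s) * of_real b"
      unfolding sesq_cnj[OF assms, of y x] a b a_b_s_def(3)[symmetric]
      by (simp add: power2_eq_square algebra_simps)
    also have "\<dots> = of_real (a + 2 * t * (cmod s)\<^sup>2 + t\<^sup>2 * (cmod s)\<^sup>2 * b)"
      unfolding complex_norm_square[symmetric] by simp
    finally show ?thesis by (simp add: less_eq_complex_def)
  qed
  have "(cmod s)\<^sup>2 \<le> a * b"
  proof (cases "b = 0")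
    case True
    have "(cmod s)\<^sup>2 = 0"
    proof (rule ccontr)
      assume "(cmod s)\<^sup>2 \<noteq> 0"
      with key[of "- (a + 1) / (2 * (cmod s)\<^sup>2)"] True show False by (simp add: field_simps)
    qed
    thus ?thesis using True by simp
  next
    case False
    hence "b > 0" using ab0 by simp
    have "0 \<le> a + 2 * (-1/b) * (cmod s)\<^sup>2 + (-1/b)\<^sup>2 * (cmod s)\<^sup>2 * b" by (rule key)
    also have "\<dots> = a - (cmod s)\<^sup>2 / b" using \<open>b > 0\<close> by (simp add: field_simps power2_eq_square)
    finally show ?thesis using \<open>b > 0\<close> by (simp add: field_simps)
  qed
  thus ?thesis by (simp add: a_b_s_def)
qed

lemma psd_fun_diag_nonneg: "psd_fun n F \<Longrightarrow> i < n \<Longrightarrow> 0 \<le> F (i,i)"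
  using sesq_unit[of i n i F] unfolding psd_fun_def by metis

lemma psd_fun_entry_bound:
  assumes "psd_fun n F" "i < n" "j < n"
  shows "(cmod (F (i,j)))\<^sup>2 \<le> Re (F (i,i)) * Re (F (j,j))"
  using sesq_CS[OF assms(1), of "\<lambda>k. if k = i then 1 else 0" "\<lambda>k. if k = j then 1 else 0"]
  by (simp add: sesq_unit assms)

lemma sesq_rank_one:
  "sesq n (\<lambda>(i,j). z i * cnj (z j)) x x = of_real ((cmod (\<Sum>j<n. cnj (z j) * x j))\<^sup>2)"
proof -
  have "sesq n (\<lambda>(i,j). z i * cnj (z j)) x x = (\<Sum>j<n. cnj (z j) * x j) * cnj (\<Sum>j<n. cnj (z j) * x j)"
    unfolding sesq_def by (simp add: sum_product ac_simps) (subst sum.swap, rule refl)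
  thus ?thesis by (simp only: complex_norm_square)
qed

lemma psd_fun_rank_one: "psd_fun n (\<lambda>(i,j). z i * cnj (z j))"
  unfolding psd_fun_def sesq_rank_one by (auto simp: less_eq_complex_def)

lemma sesq_diff: "sesq n (\<lambda>p. F p - G p) x y = sesq n F x y - sesq n G x y"
  unfolding sesq_def by (simp add: algebra_simps sum_subtractf)

lemma sesq_add: "sesq n (\<lambda>p. F p + G p) x y = sesq n F x y + sesq n G x y"
  unfolding sesq_def by (simp add: algebra_simps sum.distrib)

lemma sesq_smult: "sesq n (\<lambda>p. c * F p) x y = c * sesq n F x y"
  unfolding sesq_def by (simp add: algebra_simps sum_distrib_left)

text \<open>Cholesky factorisation by successive elimination of rows: each step subtracts a
  rank-one matrix and the remainder stays positive by Cauchy--Schwarz.\<close>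

lemma psd_fun_factor_step:
  assumes "psd_fun n F" "k \<le> n"
  shows "\<exists>z. psd_fun n (\<lambda>(i,j). F (i,j) - (\<Sum>l<k. z l i * cnj (z l j))) \<and>
    (\<forall>i<k. \<forall>j<n. F (i,j) = (\<Sum>l<k. z l i * cnj (z l j)))"
  using assms(2)
proof (induction k)
  case 0
  have "psd_fun n (\<lambda>(i,j). F (i,j) - 0)" using assms(1) by simp
  thus ?case by simp
next
  case (Suc k)
  then obtain z where z: "psd_fun n (\<lambda>(i,j). F (i,j) - (\<Sum>l<k. z l i * cnj (z l j)))"
    "\<And>i j. i < k \<Longrightarrow> j < n \<Longrightarrow> F (i,j) = (\<Sum>l<k. z l i * cnj (z l j))" by auto
  define R where "R = (\<lambda>(i,j). F (i,j) - (\<Sum>l<k. z l i * cnj (z l j)))"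
  have R: "psd_fun n R" using z(1) by (simp add: R_def)
  have kn: "k < n" using Suc.prems by simp
  define d where "d = Re (R (k,k))"
  have Rkk: "R (k,k) = of_real d" and d0: "d \<ge> 0"
    using psd_fun_diag_nonneg[OF R kn] by (auto simp: d_def less_eq_complex_def complex_eq_iff)
  define w where "w = (\<lambda>i. R (i,k) / of_real (sqrt d))"
  have dz: "R (k,j) = 0" if "d = 0" "j < n" for j
    using psd_fun_entry_bound[OF R kn that(2)] that by (simp add: d_def)
  have ww: "w i * cnj (w j) = R (i,k) * R (k,j) / of_real d" if "i < n" "j < n" for i j
    using psd_fun_hermitian[OF R that(2) kn] d0
    by (simp add: w_def flip: of_real_mult)
  have row: "w k * cnj (w j) = R (k,j)" if "j < n" for j
    using ww[OF kn that] Rkk dz[OF _ that] by (cases "d = 0") auto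
  have wsum: "(\<Sum>j<n. cnj (w j) * x j) = (\<Sum>j<n. R (k,j) * x j) / of_real (sqrt d)" for x
    unfolding sum_divide_distrib
    by (intro sum.cong refl) (simp add: w_def psd_fun_hermitian[OF R _ kn])
  have psd: "psd_fun n (\<lambda>(i,j). R (i,j) - w i * cnj (w j))"
    unfolding psd_fun_def
  proof
    fix x
    have pos: "0 \<le> sesq n R x x" using R unfolding psd_fun_def by blast
    have "(cmod (\<Sum>j<n. R (k,j) * x j))\<^sup>2 \<le> d * Re (sesq n R x x)"
      using sesq_CS[OF R, of "\<lambda>i. if i = k then 1 else 0" x] kn
      by (simp add: sesq_unit sesq_unit_left d_def)
    hence le: "(cmod (\<Sum>j<n. cnj (w j) * x j))\<^sup>2 \<le> Re (sesq n R x x)"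
      using d0 pos unfolding wsum
      by (cases "d = 0")
         (auto simp: norm_divide power_divide field_simps less_eq_complex_def)
    have "sesq n (\<lambda>(i,j). R (i,j) - w i * cnj (w j)) x x
      = sesq n R x x - sesq n (\<lambda>(i,j). w i * cnj (w j)) x x"
      unfolding sesq_diff[symmetric] by (simp add: case_prod_unfold)
    thus "0 \<le> sesq n (\<lambda>(i,j). R (i,j) - w i * cnj (w j)) x x"
      unfolding sesq_rank_one using pos le by (simp add: less_eq_complex_def)
  qed
  let ?z = "z(k := w)"
  have eq: "(\<Sum>l<Suc k. ?z l i * cnj (?z l j)) = (\<Sum>l<k. z l i * cnj (z l j)) + w i * cnj (w j)" for i j
    by (simp add: sum.lessThan_Suc)
  have "psd_fun n (\<lambda>(i,j). F (i,j) - (\<Sum>l<Suc k. ?z l i * cnj (?z l j)))"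
    using psd unfolding eq by (simp add: R_def diff_diff_eq)
  moreover have "F (i,j) = (\<Sum>l<Suc k. ?z l i * cnj (?z l j))" if ij: "i < Suc k" "j < n" for i j
  proof (cases "i = k")
    case True
    thus ?thesis unfolding eq using row[OF ij(2)] by (simp add: R_def)
  next
    case False
    hence ik: "i < k" using ij by simp
    have "R (i,k) = 0" using z(2)[OF ik kn] by (simp add: R_def)
    thus ?thesis unfolding eq using z(2)[OF ik ij(2)] by (simp add: w_def)
  qed
  ultimately show ?case by blast
qed

lemma psd_fun_factor:
  assumes "psd_fun n F"
  obtains z where "\<And>i j. i < n \<Longrightarrow> j < n \<Longrightarrow> F (i,j) = (\<Sum>l<n. z l i * cnj (z l j))"
  using psd_fun_factor_step[OF assms order_refl] by blast

lemma sum_lessThan_mult: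
  fixes f :: "nat \<Rightarrow> 'a :: comm_monoid_add"
  shows "(\<Sum>i<n*m. f i) = (\<Sum>a<n. \<Sum>p<m. f (a*m+p))"
proof -
  have "sum f {a*m..<a*m+m} = (\<Sum>p<m. f (a*m+p))" for a
    by (rule sum.reindex_bij_witness[of _ "\<lambda>p. a*m+p" "\<lambda>i. i - a*m"]) auto
  thus ?thesis by (simp flip: sum.nat_group[of f m n])
qed

lemma mult_add_less:
  fixes a p n m :: nat
  assumes "a < n" "p < m"
  shows "a*m+p < n*m"
proof -
  have "a*m+p < Suc a * m" using assms by simp
  also have "\<dots> \<le> n*m" using assms by (intro mult_le_mono1) simp
  finally show ?thesis .
qed

lemma div_mod_less:
  fixes i n m :: nat
  assumes "i < n*m"
  shows "i div m < n" "i mod m < m" "i div m * m + i mod m = i"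
proof -
  have "m > 0" using assms by (cases m) auto
  thus "i div m < n" "i mod m < m" "i div m * m + i mod m = i"
    using assms by (auto simp: less_mult_imp_div_less)
qed

lemma eq_mat_blockI:
  assumes "A \<in> carrier_mat (n*m) (n*m)" "B \<in> carrier_mat (n*m) (n*m)"
    and "\<And>a p b q. a < n \<Longrightarrow> p < m \<Longrightarrow> b < n \<Longrightarrow> q < m \<Longrightarrow> A $$ (a*m+p, b*m+q) = B $$ (a*m+p, b*m+q)"
  shows "A = B"
proof (rule eq_matI)
  fix i j assume "i < dim_row B" "j < dim_col B"
  hence "i < n*m" "j < n*m" using assms by auto
  thus "A $$ (i,j) = B $$ (i,j)"
    using assms(3)[of "i div m" "i mod m" "j div m" "j mod m"] by (simp add: div_mod_less)
qed (use assms in auto)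

lemma sesq_mult:
  "sesq (n*m) F x y = (\<Sum>a<n. \<Sum>p<m. \<Sum>b<n. \<Sum>q<m. cnj (x (a*m+p)) * F (a*m+p, b*m+q) * y (b*m+q))"
  unfolding sesq_def by (simp add: sum_lessThan_mult)

lemma kron_carrier[simp]:
  "A \<in> carrier_mat n n \<Longrightarrow> B \<in> carrier_mat m m \<Longrightarrow> kron A B \<in> carrier_mat (n*m) (n*m)"
  by (auto simp: kron_def)

lemma kron_index:
  assumes "A \<in> carrier_mat n n" "B \<in> carrier_mat m m" "a < n" "p < m" "b < n" "q < m"
  shows "kron A B $$ (a*m+p, b*m+q) = A $$ (a,b) * B $$ (p,q)"
  using assms mult_add_less[OF assms(3,4)] mult_add_less[OF assms(5,6)]
  by (auto simp: kron_def)

lemma sum_sandwich: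
  fixes f :: "'a \<Rightarrow> 'c :: semiring_0"
  shows "sum f A * c * sum g B = (\<Sum>a\<in>A. \<Sum>b\<in>B. f a * c * g b)"
  by (simp only: sum_distrib_right[of f A c] sum_product)

lemma sum_regroup:
  fixes f :: "_ \<Rightarrow> _ \<Rightarrow> _ \<Rightarrow> _ \<Rightarrow> _ \<Rightarrow> 'a :: comm_monoid_add"
  shows "(\<Sum>a\<in>A. \<Sum>p\<in>B. \<Sum>b\<in>C. \<Sum>q\<in>D. \<Sum>l\<in>L. f a p b q l)
    = (\<Sum>l\<in>L. \<Sum>p\<in>B. \<Sum>q\<in>D. \<Sum>a\<in>A. \<Sum>b\<in>C. f a p b q l)"
  by (simp only: sum.swap[of _ L] sum.swap[of _ D C] sum.swap[of _ D A] sum.swap[of _ B A])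

lemma psd_kron:
  assumes "psd n A" "psd m B"
  shows "psd (n*m) (kron A B)"
proof -
  have A: "A \<in> carrier_mat n n" "psd_fun n (($$) A)" and B: "B \<in> carrier_mat m m" "psd_fun m (($$) B)"
    using assms by (auto simp: psd_iff)
  obtain z where z: "\<And>i j. i < n \<Longrightarrow> j < n \<Longrightarrow> A $$ (i,j) = (\<Sum>l<n. z l i * cnj (z l j))"
    using psd_fun_factor[OF A(2)] by blast
  have "0 \<le> sesq (n*m) (($$) (kron A B)) x x" for x
  proof -
    let ?u = "\<lambda>l q. \<Sum>b<n. cnj (z l b) * x (b*m+q)"
    have ent: "kron A B $$ (a*m+p, b*m+q) = (\<Sum>l<n. z l a * cnj (z l b) * B $$ (p,q))"
      if "a < n" "p < m" "b < n" "q < m" for a p b q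
      using that by (simp add: kron_index[OF A(1) B(1)] z sum_distrib_right)
    have "sesq (n*m) (($$) (kron A B)) x x
      = (\<Sum>a<n. \<Sum>p<m. \<Sum>b<n. \<Sum>q<m. \<Sum>l<n. cnj (x (a*m+p)) * (z l a * cnj (z l b) * B $$ (p,q)) * x (b*m+q))"
      unfolding sesq_mult
      by (intro sum.cong refl) (simp only: ent lessThan_iff sum_distrib_left sum_distrib_right)
    also have "\<dots> = (\<Sum>l<n. \<Sum>p<m. \<Sum>q<m. \<Sum>a<n. \<Sum>b<n. cnj (x (a*m+p)) * (z l a * cnj (z l b) * B $$ (p,q)) * x (b*m+q))"
      by (rule sum_regroup)
    also have "\<dots> = (\<Sum>l<n. sesq m (($$) B) (?u l) (?u l))"
      unfolding sesq_def
      by (intro sum.cong refl)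
         (simp only: cnj_sum sum_sandwich, simp add: mult_ac)
    also have "0 \<le> \<dots>"
      using B(2) unfolding psd_fun_def by (intro sum_nonneg) blast
    finally show ?thesis .
  qed
  thus ?thesis using A B by (simp add: psd_iff psd_fun_def)
qed

section \<open>Matrix algebra\<close>

declare index_mult_mat(1)[simp del]

lemma dagger_carrier[simp]: "A \<in> carrier_mat n m \<Longrightarrow> dagger A \<in> carrier_mat m n"
  by (auto simp: dagger_def)

lemma dagger_index: "A \<in> carrier_mat n m \<Longrightarrow> i < m \<Longrightarrow> j < n \<Longrightarrow> dagger A $$ (i,j) = cnj (A $$ (j,i))"
  by (auto simp: dagger_def)

lemma dagger_dagger: "dagger (dagger A) = A"
  by (rule eq_matI) (auto simp: dagger_def)

lemma mult_index:
  assumes "A \<in> carrier_mat n m" "B \<in> carrier_mat m k" "i < n" "j < k"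
  shows "(A * B) $$ (i,j) = (\<Sum>l<m. A $$ (i,l) * B $$ (l,j))"
  using assms by (auto simp: index_mult_mat(1) scalar_prod_def atLeast0LessThan intro!: sum.cong)

lemma mult_carrier_square[simp]:
  "A \<in> carrier_mat n n \<Longrightarrow> B \<in> carrier_mat n n \<Longrightarrow> A * B \<in> carrier_mat n n"
  by (rule mult_carrier_mat)

lemma dagger_mult:
  assumes "A \<in> carrier_mat n m" "B \<in> carrier_mat m k"
  shows "dagger (A * B) = dagger B * dagger A"
proof (rule eq_matI)
  fix i j assume "i < dim_row (dagger B * dagger A)" "j < dim_col (dagger B * dagger A)"
  hence ij: "i < k" "j < n" using assms by (auto simp: dagger_def)
  have "dagger (A * B) $$ (i,j) = cnj ((A * B) $$ (j,i))"
    using assms ij by (intro dagger_index) auto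
  also have "\<dots> = (dagger B * dagger A) $$ (i,j)"
    using ij by (simp add: mult_index[OF assms] dagger_index[OF assms(1)] dagger_index[OF assms(2)]
      mult_index[OF dagger_carrier[OF assms(2)] dagger_carrier[OF assms(1)]] mult.commute)
  finally show "dagger (A * B) $$ (i,j) = (dagger B * dagger A) $$ (i,j)" .
qed (use assms in \<open>auto simp: dagger_def\<close>)

lemma mtrace_carrier: "A \<in> carrier_mat n n \<Longrightarrow> mtrace A = (\<Sum>i<n. A $$ (i,i))"
  by (auto simp: mtrace_def)

lemma mtrace_mult:
  assumes "A \<in> carrier_mat n m" "B \<in> carrier_mat m n"
  shows "mtrace (A * B) = (\<Sum>i<n. \<Sum>j<m. A $$ (i,j) * B $$ (j,i))"
  using assms by (simp add: mtrace_carrier[of _ n] mult_index[OF assms])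

lemma mtrace_mult_commute:
  assumes "A \<in> carrier_mat n m" "B \<in> carrier_mat m n"
  shows "mtrace (A * B) = mtrace (B * A)"
  unfolding mtrace_mult[OF assms] mtrace_mult[OF assms(2,1)] by (subst sum.swap) (simp add: mult.commute)

lemma mtrace_add:
  "A \<in> carrier_mat n n \<Longrightarrow> B \<in> carrier_mat n n \<Longrightarrow> mtrace (A + B) = mtrace A + mtrace B"
  by (auto simp: mtrace_def sum.distrib)

lemma mtrace_minus:
  "A \<in> carrier_mat n n \<Longrightarrow> B \<in> carrier_mat n n \<Longrightarrow> mtrace (A - B) = mtrace A - mtrace B"
  by (auto simp: mtrace_def sum_subtractf)

lemma mtrace_smult: "A \<in> carrier_mat n n \<Longrightarrow> mtrace (c \<cdot>\<^sub>m A) = c * mtrace A"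
  by (auto simp: mtrace_def sum_distrib_left)

lemma mtrace_one: "mtrace (1\<^sub>m n) = of_nat n"
  by (simp add: mtrace_def)

lemma kron_mult:
  assumes A: "A \<in> carrier_mat n n" and B: "B \<in> carrier_mat m m"
    and C: "C \<in> carrier_mat n n" and D: "D \<in> carrier_mat m m"
  shows "kron A B * kron C D = kron (A * C) (B * D)"
proof (rule eq_mat_blockI[of _ n m])
  fix a p b q assume i: "a < n" "p < m" "b < n" "q < m"
  have "(kron A B * kron C D) $$ (a*m+p, b*m+q)
      = (\<Sum>c<n. \<Sum>r<m. kron A B $$ (a*m+p, c*m+r) * kron C D $$ (c*m+r, b*m+q))"
    using mult_add_less[OF i(1,2)] mult_add_less[OF i(3,4)]
    by (simp add: mult_index[OF kron_carrier[OF A B] kron_carrier[OF C D]] sum_lessThan_mult)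
  also have "\<dots> = (\<Sum>c<n. \<Sum>r<m. (A $$ (a,c) * C $$ (c,b)) * (B $$ (p,r) * D $$ (r,q)))"
    using i by (intro sum.cong refl) (simp add: kron_index[OF A B] kron_index[OF C D])
  also have "\<dots> = kron (A * C) (B * D) $$ (a*m+p, b*m+q)"
    using A B C D i by (simp add: kron_index[of _ n _ m] mult_index[of _ n n _ n] mult_index[of _ m m _ m] sum_product)
  finally show "(kron A B * kron C D) $$ (a*m+p, b*m+q) = kron (A * C) (B * D) $$ (a*m+p, b*m+q)" .
qed (use assms in \<open>auto intro!: mult_carrier_mat kron_carrier\<close>)

lemma dagger_kron:
  assumes A: "A \<in> carrier_mat n n" and B: "B \<in> carrier_mat m m"
  shows "dagger (kron A B) = kron (dagger A) (dagger B)"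
proof (rule eq_mat_blockI[of _ n m])
  fix a p b q assume i: "a < n" "p < m" "b < n" "q < m"
  show "dagger (kron A B) $$ (a*m+p, b*m+q) = kron (dagger A) (dagger B) $$ (a*m+p, b*m+q)"
    using i mult_add_less[OF i(1,2)] mult_add_less[OF i(3,4)]
    by (simp add: dagger_index[OF kron_carrier[OF A B]] kron_index[OF A B] kron_index[of _ n _ m]
        dagger_index[OF A] dagger_index[OF B] A B)
qed (use assms in auto)

lemma kron_one: "kron (1\<^sub>m n) (1\<^sub>m m) = 1\<^sub>m (n*m)"
proof (rule eq_mat_blockI[of _ n m])
  fix a p b q assume i: "a < n" "p < m" "b < n" "q < m"
  have "a*m+p = b*m+q \<longleftrightarrow> a = b \<and> p = q"
  proof
    assume eq: "a*m+p = b*m+q"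
    hence "(a*m+p) div m = (b*m+q) div m" "(a*m+p) mod m = (b*m+q) mod m" by simp_all
    thus "a = b \<and> p = q" using i by simp
  qed simp
  thus "kron (1\<^sub>m n) (1\<^sub>m m) $$ (a*m+p, b*m+q) = (1\<^sub>m (n*m) :: complex mat) $$ (a*m+p, b*m+q)"
    using i mult_add_less[OF i(1,2)] mult_add_less[OF i(3,4)] by (auto simp: kron_index[of _ n _ m])
qed (auto intro!: kron_carrier)

lemma mtrace_kron:
  assumes "A \<in> carrier_mat n n" "B \<in> carrier_mat m m"
  shows "mtrace (kron A B) = mtrace A * mtrace B"
  using assms
  by (simp add: mtrace_carrier[of _ n] mtrace_carrier[of _ m] mtrace_carrier[OF kron_carrier[OF assms]]
      sum_lessThan_mult kron_index[OF assms] sum_product)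

lemma conj_index:
  assumes "V \<in> carrier_mat n n" "M \<in> carrier_mat n n" "i < n" "j < n"
  shows "(V * M * dagger V) $$ (i,j) = (\<Sum>k<n. \<Sum>l<n. V $$ (i,k) * cnj (V $$ (j,l)) * M $$ (k,l))"
proof -
  have "(V * M * dagger V) $$ (i,j) = (\<Sum>l<n. (\<Sum>k<n. V $$ (i,k) * M $$ (k,l)) * cnj (V $$ (j,l)))"
    using assms by (simp add: mult_index[of _ n n _ n] dagger_index[of _ n n])
  also have "\<dots> = (\<Sum>l<n. \<Sum>k<n. V $$ (i,k) * cnj (V $$ (j,l)) * M $$ (k,l))"
    by (simp add: sum_distrib_left sum_distrib_right mult_ac)
  finally show ?thesis by (subst sum.swap)
qed

lemma sum_swap_pairs:
  fixes f :: "_ \<Rightarrow> _ \<Rightarrow> _ \<Rightarrow> _ \<Rightarrow> 'a :: comm_monoid_add"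
  shows "(\<Sum>i\<in>A. \<Sum>j\<in>B. \<Sum>k\<in>C. \<Sum>l\<in>D. f i j k l) = (\<Sum>k\<in>C. \<Sum>l\<in>D. \<Sum>i\<in>A. \<Sum>j\<in>B. f i j k l)"
  by (simp only: sum.swap[of _ C B] sum.swap[of _ D B] sum.swap[of _ C A] sum.swap[of _ D A])

lemma sesq_conj:
  assumes "V \<in> carrier_mat n n" "M \<in> carrier_mat n n"
  shows "sesq n (($$) (V * M * dagger V)) x y
    = sesq n (($$) M) (\<lambda>k. \<Sum>i<n. cnj (V $$ (i,k)) * x i) (\<lambda>k. \<Sum>i<n. cnj (V $$ (i,k)) * y i)"
proof -
  have "sesq n (($$) (V * M * dagger V)) x y
    = (\<Sum>i<n. \<Sum>j<n. \<Sum>k<n. \<Sum>l<n. cnj (x i) * (V $$ (i,k) * cnj (V $$ (j,l)) * M $$ (k,l)) * y j)"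
    by (simp add: sesq_def conj_index[OF assms] sum_distrib_left sum_distrib_right)
  also have "\<dots> = (\<Sum>k<n. \<Sum>l<n. \<Sum>i<n. \<Sum>j<n. cnj (x i) * (V $$ (i,k) * cnj (V $$ (j,l)) * M $$ (k,l)) * y j)"
    by (rule sum_swap_pairs)
  also have "\<dots> = sesq n (($$) M) (\<lambda>k. \<Sum>i<n. cnj (V $$ (i,k)) * x i) (\<lambda>k. \<Sum>i<n. cnj (V $$ (i,k)) * y i)"
    unfolding sesq_def cnj_sum sum_sandwich by (intro sum.cong refl) (simp add: mult_ac)
  finally show ?thesis .
qed

lemma psd_conj:
  assumes "V \<in> carrier_mat n n" "psd n M"
  shows "psd n (V * M * dagger V)"
  using assms by (auto simp: psd_iff psd_fun_def sesq_conj intro!: mult_carrier_mat)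

lemma unitary_carrier: "unitary n U \<Longrightarrow> U \<in> carrier_mat n n"
  by (simp add: unitary_def)

lemma unitary_left:
  assumes "unitary n U"
  shows "dagger U * U = 1\<^sub>m n"
  using assms mat_mult_left_right_inverse[of U n "dagger U"] by (auto simp: unitary_def)

lemma unitary_kron:
  assumes "unitary n U" "unitary m W"
  shows "unitary (n*m) (kron U W)"
  using assms by (auto simp: unitary_def dagger_kron[of _ n _ m] kron_mult[of _ n _ m] kron_one)

lemma cconj_mat_carrier[simp]: "U \<in> carrier_mat n m \<Longrightarrow> cconj_mat U \<in> carrier_mat n m"
  by (auto simp: cconj_mat_def)

lemma cconj_mat_index: "U \<in> carrier_mat n m \<Longrightarrow> i < n \<Longrightarrow> j < m \<Longrightarrow> cconj_mat U $$ (i,j) = cnj (U $$ (i,j))"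
  by (auto simp: cconj_mat_def)

lemma cconj_mat_mult:
  assumes "A \<in> carrier_mat n m" "B \<in> carrier_mat m k"
  shows "cconj_mat (A * B) = cconj_mat A * cconj_mat B"
proof (rule eq_matI)
  fix i j assume "i < dim_row (cconj_mat A * cconj_mat B)" "j < dim_col (cconj_mat A * cconj_mat B)"
  hence ij: "i < n" "j < k" using assms by (auto simp: cconj_mat_def)
  thus "cconj_mat (A * B) $$ (i,j) = (cconj_mat A * cconj_mat B) $$ (i,j)"
    using assms by (simp add: cconj_mat_index[of _ n k] mult_index[OF assms]
       mult_index[of _ n m _ k] cconj_mat_index[of _ n m] cconj_mat_index[of _ m k])
qed (use assms in \<open>auto simp: cconj_mat_def\<close>)

lemma unitary_cconj:
  assumes "unitary n U"
  shows "unitary n (cconj_mat U)"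
proof -
  have U: "U \<in> carrier_mat n n" using assms by (rule unitary_carrier)
  have "dagger (cconj_mat U) = cconj_mat (dagger U)"
    using U by (intro eq_matI) (auto simp: dagger_def cconj_mat_def)
  hence "cconj_mat U * dagger (cconj_mat U) = cconj_mat (U * dagger U)"
    using U by (simp add: cconj_mat_mult[of _ n n _ n])
  also have "\<dots> = 1\<^sub>m n"
    using assms by (auto simp: unitary_def cconj_mat_def intro!: eq_matI)
  finally show ?thesis using U by (simp add: unitary_def)
qed

lemma unitary_rep_cconj:
  assumes "unitary_rep gmul n U"
  shows "unitary_rep gmul n (\<lambda>g. cconj_mat (U g))"
  unfolding unitary_rep_def
proof (intro conjI allI impI)
  have U: "U g \<in> carrier_mat n n" for g using assms by (auto simp: unitary_rep_def unitary_def)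
  fix g h show "unitary n (cconj_mat (U g))" using assms by (auto simp: unitary_rep_def intro!: unitary_cconj)
  show "cconj_mat (U (gmul g h)) = cconj_mat (U g) * cconj_mat (U h)"
    using assms U by (simp add: unitary_rep_def flip: cconj_mat_mult[of _ n n _ n])
  fix i j assume "i < n" "j < n"
  moreover from this have "continuous_on UNIV (\<lambda>g. cnj (U g $$ (i,j)))"
    using assms by (intro continuous_on_cnj) (auto simp: unitary_rep_def)
  ultimately show "continuous_on UNIV (\<lambda>g. cconj_mat (U g) $$ (i,j))"
    using U by (simp add: cconj_mat_index[OF U])
qed

lemma unitary_rep_kron:
  assumes "unitary_rep gmul n U" "unitary_rep gmul m W"
  shows "unitary_rep gmul (n*m) (\<lambda>g. kron (U g) (W g))"
  unfolding unitary_rep_def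
proof (intro conjI allI impI)
  have U: "U g \<in> carrier_mat n n" and W: "W g \<in> carrier_mat m m" for g
    using assms by (auto simp: unitary_rep_def unitary_def)
  fix g h show "unitary (n*m) (kron (U g) (W g))" using assms by (auto simp: unitary_rep_def intro!: unitary_kron)
  show "kron (U (gmul g h)) (W (gmul g h)) = kron (U g) (W g) * kron (U h) (W h)"
    using assms U W by (simp add: unitary_rep_def kron_mult[of _ n _ m])
  fix i j assume "i < n*m" "j < n*m"
  note i = div_mod_less[OF this(1)] and j = div_mod_less[OF this(2)]
  have "kron (U g) (W g) $$ (i,j) = U g $$ (i div m, j div m) * W g $$ (i mod m, j mod m)" for g
    using kron_index[OF U W i(1,2) j(1,2)] i(3) j(3) by simp
  moreover have "continuous_on UNIV (\<lambda>g. U g $$ (i div m, j div m) * W g $$ (i mod m, j mod m))"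
    using assms i j by (intro continuous_on_mult) (auto simp: unitary_rep_def)
  ultimately show "continuous_on UNIV (\<lambda>g. kron (U g) (W g) $$ (i,j))" by simp
qed

section \<open>Twirling over a compact group\<close>

locale haar_group =
  fixes gmul :: "'g::t2_space \<Rightarrow> 'g \<Rightarrow> 'g" and e :: 'g and ginv :: "'g \<Rightarrow> 'g" and \<mu> :: "'g measure"
  assumes cgroup: "compact_group gmul e ginv" and haar: "haar gmul \<mu>"
begin

lemma finite_measure_haar: "finite_measure \<mu>"
  using haar by (intro finite_measureI) (auto simp: haar_def)

lemma sets_haar[measurable_cong]: "sets \<mu> = sets borel"
  using haar by (simp add: haar_def)

lemma space_haar: "space \<mu> = UNIV"
  using sets_eq_imp_space_eq[OF sets_haar] by simp

lemma measure_haar: "measure \<mu> (space \<mu>) = 1"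
  using haar by (simp add: haar_def measure_def)

lemma integrable_continuous:
  fixes f :: "'g \<Rightarrow> complex"
  assumes "continuous_on UNIV f"
  shows "integrable \<mu> f"
proof -
  have "compact (UNIV :: 'g set)" using cgroup by (simp add: compact_group_def)
  hence "bounded (range f)" using assms by (intro compact_imp_bounded compact_continuous_image)
  then obtain B where B: "\<And>g. norm (f g) \<le> B" by (auto simp: bounded_iff)
  have "f \<in> borel_measurable \<mu>"
    using borel_measurable_continuous_onI[OF assms] by (simp add: measurable_cong_sets[OF sets_haar refl])
  thus ?thesis
    by (rule finite_measure.integrable_const_bound[OF finite_measure_haar, rotated]) (use B in auto)
qed

lemma left_inverse: "gmul (ginv h) (gmul h x) = x"
  using cgroup unfolding compact_group_def by metis

lemma right_inverse: "gmul h (gmul (ginv h) x) = x"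
proof -
  have "gmul h (ginv h) = gmul (gmul (ginv (ginv h)) (ginv h)) (gmul h (ginv h))"
    using cgroup unfolding compact_group_def by metis
  also have "\<dots> = e"
    using cgroup unfolding compact_group_def by metis
  finally show ?thesis using cgroup unfolding compact_group_def by metis
qed

lemma continuous_gmul: "continuous_on UNIV (gmul h)"
proof -
  have "continuous_on UNIV (\<lambda>p. gmul (fst p) (snd p))" using cgroup by (simp add: compact_group_def)
  from continuous_on_compose2[OF this, of UNIV "\<lambda>x. (h, x)"] show ?thesis
    by (simp add: continuous_on_Pair continuous_on_id)
qed

lemma distr_gmul: "distr \<mu> \<mu> (gmul h) = \<mu>"
proof (rule measure_eqI)
  have meas: "gmul h \<in> measurable \<mu> \<mu>"
    using borel_measurable_continuous_onI[OF continuous_gmul]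
    by (simp add: measurable_cong_sets[OF sets_haar sets_haar])
  fix S assume S: "S \<in> sets (distr \<mu> \<mu> (gmul h))"
  have "gmul h -` S = gmul (ginv h) ` S"
  proof (intro equalityI subsetI)
    fix x assume "x \<in> gmul h -` S"
    thus "x \<in> gmul (ginv h) ` S" by (intro image_eqI[of _ _ "gmul h x"]) (auto simp: left_inverse)
  qed (auto simp: right_inverse)
  thus "emeasure (distr \<mu> \<mu> (gmul h)) S = emeasure \<mu> S"
    using S meas haar by (simp add: emeasure_distr space_haar haar_def)
qed simp

lemma integral_gmul:
  fixes f :: "'g \<Rightarrow> complex"
  assumes "continuous_on UNIV f"
  shows "(\<integral>g. f (gmul h g) \<partial>\<mu>) = (\<integral>g. f g \<partial>\<mu>)"
proof -
  have meas: "gmul h \<in> measurable \<mu> \<mu>"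
    using borel_measurable_continuous_onI[OF continuous_gmul]
    by (simp add: measurable_cong_sets[OF sets_haar sets_haar])
  have "f \<in> borel_measurable \<mu>"
    using borel_measurable_continuous_onI[OF assms] by (simp add: measurable_cong_sets[OF sets_haar refl])
  from integral_distr[OF meas this] show ?thesis by (simp add: distr_gmul)
qed

end

locale rep = haar_group +
  fixes n :: nat and V :: "'a::t2_space \<Rightarrow> complex mat"
  assumes unitary_rep: "unitary_rep gmul n V"
begin

abbreviation conj :: "'a \<Rightarrow> complex mat \<Rightarrow> complex mat" where "conj g M \<equiv> V g * M * dagger (V g)"
abbreviation tw :: "complex mat \<Rightarrow> complex mat" where "tw M \<equiv> twirl \<mu> n V M"

lemma V_carrier[simp]: "V g \<in> carrier_mat n n"
  using unitary_rep by (auto simp: unitary_rep_def unitary_def)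

lemma conj_carrier[simp]: "M \<in> carrier_mat n n \<Longrightarrow> conj g M \<in> carrier_mat n n"
  by (intro mult_carrier_mat[of _ n n]) auto

lemma V_left: "dagger (V g) * V g = 1\<^sub>m n"
  using unitary_rep by (auto simp: unitary_rep_def intro!: unitary_left)

lemma V_mult: "V (gmul g h) = V g * V h"
  using unitary_rep by (auto simp: unitary_rep_def)

lemma continuous_conj:
  assumes "M \<in> carrier_mat n n" "i < n" "j < n"
  shows "continuous_on UNIV (\<lambda>g. conj g M $$ (i,j))"
proof -
  have "continuous_on UNIV (\<lambda>g. \<Sum>k<n. \<Sum>l<n. V g $$ (i,k) * cnj (V g $$ (j,l)) * M $$ (k,l))"
    using unitary_rep assms
    by (intro continuous_on_sum continuous_on_mult continuous_on_cnj continuous_on_const)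
       (auto simp: unitary_rep_def)
  thus ?thesis using assms by (simp add: conj_index[of _ n])
qed

lemma integrable_conj:
  "M \<in> carrier_mat n n \<Longrightarrow> i < n \<Longrightarrow> j < n \<Longrightarrow> integrable \<mu> (\<lambda>g. conj g M $$ (i,j))"
  by (intro integrable_continuous continuous_conj)

lemma tw_carrier[simp]: "tw M \<in> carrier_mat n n"
  by (simp add: twirl_def)

lemma tw_index: "i < n \<Longrightarrow> j < n \<Longrightarrow> tw M $$ (i,j) = (\<integral>g. conj g M $$ (i,j) \<partial>\<mu>)"
  by (simp add: twirl_def)

lemma sum_tw:
  assumes "M \<in> carrier_mat n n"
  shows "(\<Sum>i<n. \<Sum>j<n. c i j * tw M $$ (i,j)) = (\<integral>g. (\<Sum>i<n. \<Sum>j<n. c i j * conj g M $$ (i,j)) \<partial>\<mu>)"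
proof -
  have int: "integrable \<mu> (\<lambda>g. c i j * conj g M $$ (i,j))" if "i < n" "j < n" for i j
    using integrable_conj[OF assms that] by simp
  have "(\<integral>g. (\<Sum>i<n. \<Sum>j<n. c i j * conj g M $$ (i,j)) \<partial>\<mu>) = (\<Sum>i<n. \<integral>g. (\<Sum>j<n. c i j * conj g M $$ (i,j)) \<partial>\<mu>)"
    using int by (intro Bochner_Integration.integral_sum integrable_sum) auto
  also have "\<dots> = (\<Sum>i<n. \<Sum>j<n. \<integral>g. c i j * conj g M $$ (i,j) \<partial>\<mu>)"
    using int by (intro sum.cong refl Bochner_Integration.integral_sum) auto
  finally show ?thesis by (simp add: tw_index)
qed

lemma sesq_tw:
  assumes "M \<in> carrier_mat n n"
  shows "sesq n (($$) (tw M)) x y = (\<integral>g. sesq n (($$) (conj g M)) x y \<partial>\<mu>)"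
proof -
  have *: "sesq n (($$) A) x y = (\<Sum>i<n. \<Sum>j<n. (cnj (x i) * y j) * A $$ (i,j))" for A :: "complex mat"
    by (simp add: sesq_def mult_ac)
  show ?thesis unfolding * by (rule sum_tw[OF assms])
qed

lemma mtrace_mult_tw:
  assumes "M \<in> carrier_mat n n" "N \<in> carrier_mat n n"
  shows "mtrace (tw M * N) = (\<integral>g. mtrace (conj g M * N) \<partial>\<mu>)"
proof -
  have *: "mtrace (A * N) = (\<Sum>i<n. \<Sum>j<n. N $$ (j,i) * A $$ (i,j))" if "A \<in> carrier_mat n n" for A
    by (simp add: mtrace_mult[OF that assms(2)] mult.commute)
  show ?thesis using assms by (simp add: * sum_tw)
qed

lemma psd_tw:
  assumes "psd n M"
  shows "psd n (tw M)"
proof -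
  have M: "M \<in> carrier_mat n n" using assms by (simp add: psd_iff)
  have "0 \<le> sesq n (($$) (tw M)) x x" for x
  proof -
    define f where "f = (\<lambda>g. sesq n (($$) (conj g M)) x x)"
    have pos: "0 \<le> f g" for g
      using psd_conj[OF V_carrier assms] by (auto simp: f_def psd_iff psd_fun_def)
    hence "f = (\<lambda>g. of_real (Re (f g)))" by (auto simp: less_eq_complex_def complex_eq_iff)
    hence "(\<integral>g. f g \<partial>\<mu>) = of_real (\<integral>g. Re (f g) \<partial>\<mu>)" by (metis integral_complex_of_real)
    also have "\<dots> \<ge> 0" using pos by (simp add: less_eq_complex_def)
    finally show ?thesis using sesq_tw[OF M] by (simp add: f_def)
  qed
  thus ?thesis by (simp add: psd_iff psd_fun_def)
qed

lemma conj_conj: 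
  assumes "M \<in> carrier_mat n n"
  shows "conj h (conj g M) = conj (gmul h g) M"
  using assms by (simp add: V_mult dagger_mult[of _ n n _ n] assoc_mult_mat[of _ n n _ n _ n])

lemma conj_tw:
  assumes "M \<in> carrier_mat n n"
  shows "conj h (tw M) = tw M"
proof (rule eq_matI)
  fix i j assume "i < dim_row (tw M)" "j < dim_col (tw M)"
  hence ij: "i < n" "j < n" by (auto simp: twirl_def)
  have "conj h (tw M) $$ (i,j) = (\<integral>g. conj h (conj g M) $$ (i,j) \<partial>\<mu>)"
    using ij assms by (simp add: conj_index[OF V_carrier _ ij] sum_tw)
  also have "\<dots> = (\<integral>g. conj (gmul h g) M $$ (i,j) \<partial>\<mu>)"
    using assms by (simp add: conj_conj)
  also have "\<dots> = tw M $$ (i,j)"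
    using integral_gmul[OF continuous_conj[OF assms ij]] ij by (simp add: tw_index)
  finally show "conj h (tw M) $$ (i,j) = tw M $$ (i,j)" .
next
  have "conj h (tw M) \<in> carrier_mat n n" by simp
  thus "dim_row (conj h (tw M)) = dim_row (tw M)" "dim_col (conj h (tw M)) = dim_col (tw M)"
    unfolding carrier_mat_def by (simp_all add: twirl_def)
qed

lemma mtrace_tw_invariant:
  assumes M: "M \<in> carrier_mat n n" and N: "N \<in> carrier_mat n n" and inv: "\<And>g. conj g N = N"
  shows "mtrace (tw M * N) = mtrace (M * N)"
proof -
  have "mtrace (conj g M * N) = mtrace (M * N)" for g
  proof -
    note A = assoc_mult_mat[of _ n n _ n _ n]
    have "dagger (V g) * conj g N * V g = (dagger (V g) * V g) * N * (dagger (V g) * V g)"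
      using N by (simp add: A)
    hence inv': "dagger (V g) * N * V g = N" using N by (simp add: inv V_left)
    have "mtrace (conj g M * N) = mtrace (V g * (M * (dagger (V g) * N)))"
      using M N by (simp add: A)
    also have "\<dots> = mtrace (M * (dagger (V g) * N) * V g)"
      using M N by (intro mtrace_mult_commute[of _ n n]) (auto intro!: mult_carrier_mat[of _ n n])
    also have "\<dots> = mtrace (M * (dagger (V g) * N * V g))"
      using M N by (simp add: A)
    finally show ?thesis by (simp only: inv')
  qed
  thus ?thesis using M N by (simp add: mtrace_mult_tw measure_haar)
qed

text \<open>This replaces a change of variables \<open>g \<mapsto> g\<inverse>\<close>, so that left invariance of the Haar measure is enough.\<close>

lemma mtrace_tw_adjoint:
  assumes M: "M \<in> carrier_mat n n" and N: "N \<in> carrier_mat n n"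
  shows "mtrace (tw M * N) = mtrace (M * tw N)"
proof -
  have "mtrace (M * tw N) = mtrace (tw M * tw N)"
    using M N by (simp add: mtrace_tw_invariant conj_tw)
  also have "\<dots> = mtrace (tw N * tw M)" by (rule mtrace_mult_commute[of _ n n]) auto
  also have "\<dots> = mtrace (N * tw M)"
    using M N by (simp add: mtrace_tw_invariant conj_tw)
  also have "\<dots> = mtrace (tw M * N)" using N by (intro mtrace_mult_commute[of _ n n]) auto
  finally show ?thesis by simp
qed

lemma mtrace_tw:
  assumes "M \<in> carrier_mat n n"
  shows "mtrace (tw M) = mtrace M"
proof -
  have "conj g (1\<^sub>m n) = 1\<^sub>m n" for g
    using unitary_rep by (simp add: unitary_rep_def unitary_def right_mult_one_mat[OF V_carrier])
  from mtrace_tw_invariant[OF assms _ this] show ?thesis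
    using assms by (simp add: right_mult_one_mat[of _ n n])
qed

lemma tw_minus:
  assumes "M \<in> carrier_mat n n" "N \<in> carrier_mat n n"
  shows "tw (M - N) = tw M - tw N"
proof (rule eq_matI)
  fix i j assume "i < dim_row (tw M - tw N)" "j < dim_col (tw M - tw N)"
  hence ij: "i < n" "j < n" by (auto simp: twirl_def)
  have "conj g (M - N) $$ (i,j) = conj g M $$ (i,j) - conj g N $$ (i,j)" for g
    using assms ij by (simp add: conj_index[of _ n] minus_carrier_mat right_diff_distrib sum_subtractf)
  thus "tw (M - N) $$ (i,j) = (tw M - tw N) $$ (i,j)"
    using assms ij integrable_conj[OF assms(1) ij] integrable_conj[OF assms(2) ij]
    by (simp add: twirl_def)
qed (auto simp: twirl_def)

lemma tw_smult:
  assumes "M \<in> carrier_mat n n"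
  shows "tw (c \<cdot>\<^sub>m M) = c \<cdot>\<^sub>m tw M"
proof (rule eq_matI)
  fix i j assume "i < dim_row (c \<cdot>\<^sub>m tw M)" "j < dim_col (c \<cdot>\<^sub>m tw M)"
  hence ij: "i < n" "j < n" by (auto simp: twirl_def)
  have "conj g (c \<cdot>\<^sub>m M) $$ (i,j) = c * conj g M $$ (i,j)" for g
    using assms ij by (simp add: conj_index[of _ n] sum_distrib_left mult_ac)
  thus "tw (c \<cdot>\<^sub>m M) $$ (i,j) = (c \<cdot>\<^sub>m tw M) $$ (i,j)"
    using assms ij by (simp add: twirl_def)
qed (auto simp: twirl_def)

end

section \<open>Conditional min-entropy of twirled product states\<close>

lemma kron_smult_left:
  assumes "A \<in> carrier_mat n n" "B \<in> carrier_mat m m"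
  shows "kron (c \<cdot>\<^sub>m A) B = kron A (c \<cdot>\<^sub>m B)"
  using assms by (intro eq_mat_blockI[of _ n m]; simp add: kron_index[of _ n _ m])

lemma kron_minus_left:
  assumes "A \<in> carrier_mat n n" "A' \<in> carrier_mat n n" "B \<in> carrier_mat m m"
  shows "kron (A - A') B = kron A B - kron A' B"
  using assms
  by (intro eq_mat_blockI[of _ n m]; simp add: mult_add_less minus_carrier_mat kron_index[of _ n _ m] left_diff_distrib carrier_matD[OF kron_carrier[OF assms(2,3)]])

lemma psd_carrier: "psd n M \<Longrightarrow> M \<in> carrier_mat n n"
  by (simp add: psd_def)

lemma psd_trace_nonneg: 
  assumes "psd n M"
  shows "0 \<le> mtrace M"
proof -
  have "0 \<le> (\<Sum>i<n. M $$ (i,i))"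
    using assms by (intro sum_nonneg psd_fun_diag_nonneg) (auto simp: psd_iff)
  thus ?thesis using psd_carrier[OF assms] by (simp add: mtrace_carrier)
qed

lemma psd_smult:
  assumes "psd n M" "0 \<le> c"
  shows "psd n (of_real c \<cdot>\<^sub>m M)"
proof -
  have M: "M \<in> carrier_mat n n" "\<And>x. 0 \<le> sesq n (($$) M) x x"
    using assms by (auto simp: psd_iff psd_fun_def)
  have "sesq n (($$) (of_real c \<cdot>\<^sub>m M)) x x = of_real c * sesq n (($$) M) x x" for x
    unfolding sesq_smult[symmetric] by (rule sesq_cong) (use M(1) in auto)
  moreover have "0 \<le> of_real c * sesq n (($$) M) x x" for x
    using M(2)[of x] assms(2) by (simp add: less_eq_complex_def)
  ultimately show ?thesis using M(1) by (simp add: psd_iff psd_fun_def)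
qed

lemma psd_add:
  assumes "psd n M" "psd n N"
  shows "psd n (M + N)"
proof -
  have "sesq n (($$) (M + N)) x x = sesq n (($$) M) x x + sesq n (($$) N) x x" for x
    unfolding sesq_add[symmetric] by (rule sesq_cong) (use assms in \<open>auto simp: psd_iff\<close>)
  thus ?thesis using assms by (auto simp: psd_iff psd_fun_def)
qed

lemma psd_zero: "psd n (0\<^sub>m n n)"
proof -
  have "sesq n (($$) (0\<^sub>m n n)) x x = sesq n (\<lambda>_. 0) x x" for x
    by (rule sesq_cong) auto
  thus ?thesis by (simp add: psd_iff psd_fun_def sesq_def)
qed

lemma sesq_one: "sesq n (($$) (1\<^sub>m n)) x x = of_real (\<Sum>i<n. (cmod (x i))\<^sup>2)"
proof -
  have "sesq n (($$) (1\<^sub>m n)) x x = (\<Sum>i<n. \<Sum>j<n. if j = i then cnj (x i) * x j else 0)"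
    unfolding sesq_def by (intro sum.cong refl) auto
  also have "\<dots> = (\<Sum>i<n. of_real ((cmod (x i))\<^sup>2))"
    unfolding complex_norm_square by (simp add: mult.commute)
  finally show ?thesis by simp
qed

lemma psd_diag_dominant:
  assumes H: "H \<in> carrier_mat n n" and herm: "\<And>i j. i < n \<Longrightarrow> j < n \<Longrightarrow> H $$ (j,i) = cnj (H $$ (i,j))"
    and c: "(\<Sum>i<n. \<Sum>j<n. cmod (H $$ (i,j))) \<le> c"
  shows "psd n (of_real c \<cdot>\<^sub>m 1\<^sub>m n + H)"
proof -
  have "0 \<le> sesq n (($$) (of_real c \<cdot>\<^sub>m 1\<^sub>m n + H)) x x" for x
  proof -
    define S where "S = (\<Sum>i<n. (cmod (x i))\<^sup>2)"
    have "cnj (sesq n (($$) H) x x) = (\<Sum>i<n. \<Sum>j<n. cnj (x j) * H $$ (j,i) * x i)"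
      unfolding sesq_def cnj_sum by (intro sum.cong refl) (simp add: mult_ac flip: herm)
    also have "\<dots> = sesq n (($$) H) x x" unfolding sesq_def by (rule sum.swap)
    finally have Im: "Im (sesq n (($$) H) x x) = 0" by (simp add: complex_eq_iff)
    have le: "(cmod (x i))\<^sup>2 \<le> S" if "i < n" for i
      unfolding S_def using that by (intro member_le_sum) auto
    have "cmod (x i) * cmod (x j) \<le> S" if "i < n" "j < n" for i j
      using le[OF that(1)] le[OF that(2)] sum_squares_bound[of "cmod (x i)" "cmod (x j)"] by simp
    hence *: "cmod (H $$ (i,j)) * (cmod (x i) * cmod (x j)) \<le> cmod (H $$ (i,j)) * S" if "i < n" "j < n" for i j
      using that by (intro mult_left_mono) auto
    have "cmod (sesq n (($$) H) x x) \<le> (\<Sum>i<n. \<Sum>j<n. cmod (cnj (x i) * H $$ (i,j) * x j))"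
      unfolding sesq_def by (rule order_trans[OF norm_sum sum_mono[OF norm_sum]])
    also have "\<dots> \<le> (\<Sum>i<n. \<Sum>j<n. cmod (H $$ (i,j)) * S)"
      using * by (intro sum_mono) (simp add: norm_mult mult_ac)
    also have "\<dots> = (\<Sum>i<n. \<Sum>j<n. cmod (H $$ (i,j))) * S" by (simp add: sum_distrib_right)
    also have "\<dots> \<le> c * S" using c by (intro mult_right_mono) (auto simp: S_def intro: sum_nonneg)
    finally have "- (c * S) \<le> Re (sesq n (($$) H) x x)"
      using complex_Re_le_cmod[of "- sesq n (($$) H) x x"] by simp
    moreover have "sesq n (($$) (of_real c \<cdot>\<^sub>m 1\<^sub>m n + H)) x x = of_real c * of_real S + sesq n (($$) H) x x"
      unfolding S_def sesq_one[symmetric] sesq_smult[symmetric] sesq_add[symmetric]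
      by (rule sesq_cong) (use H in auto)
    ultimately show ?thesis using Im by (simp add: less_eq_complex_def)
  qed
  thus ?thesis using H by (simp add: psd_iff psd_fun_def)
qed

definition feas :: "nat \<Rightarrow> nat \<Rightarrow> complex mat \<Rightarrow> real set" where
  "feas dR dX \<Omega> = {Re (mtrace Y) | Y. psd dX Y \<and> psd (dR*dX) (kron (1\<^sub>m dR) Y - \<Omega>)}"

lemma hmin_feas: "hmin dR dX \<Omega> = - log 2 (Inf (feas dR dX \<Omega>))"
  by (simp add: hmin_def feas_def)

lemma feas_trace_bound:
  assumes "\<Omega> \<in> carrier_mat (d*m) (d*m)" "t \<in> feas d m \<Omega>" "d > 0"
  shows "Re (mtrace \<Omega>) / d \<le> t"
proof -
  obtain Y where t: "t = Re (mtrace Y)" and Y: "psd m Y" and psd: "psd (d*m) (kron (1\<^sub>m d) Y - \<Omega>)"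
    using assms(2) by (auto simp: feas_def)
  note Yc = psd_carrier[OF Y]
  have "mtrace (kron (1\<^sub>m d) Y - \<Omega>) = of_nat d * mtrace Y - mtrace \<Omega>"
    using Yc assms(1) by (simp add: mtrace_minus[of _ "d*m"] mtrace_kron[of _ d _ m] mtrace_one)
  with psd_trace_nonneg[OF psd] have "Re (mtrace \<Omega>) \<le> d * t"
    by (simp add: less_eq_complex_def t)
  thus ?thesis using assms(3) by (simp add: field_simps)
qed

text \<open>The unnormalised maximally entangled vector.\<close>

lemma sesq_entangled:
  "sesq (d*d) F (\<lambda>i. if i div d = i mod d then 1 else 0) (\<lambda>i. if i div d = i mod d then 1 else 0)
    = (\<Sum>a<d. \<Sum>b<d. F (a*d+a, b*d+b))"
proof -
  let ?w = "\<lambda>i. if i div d = i mod d then 1 else (0::complex)"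
  have w: "?w (a*d+p) = (if p = a then 1 else 0)" if "p < d" for a p using that by simp
  have "sesq (d*d) F ?w ?w = (\<Sum>a<d. \<Sum>p<d. \<Sum>b<d. \<Sum>q<d. if q = b then if p = a then F (a*d+p, b*d+q) else 0 else 0)"
    unfolding sesq_mult by (intro sum.cong refl) (simp add: w del: div_mult_self3 mod_mult_self3)
  also have "\<dots> = (\<Sum>a<d. \<Sum>p<d. if p = a then (\<Sum>b<d. F (a*d+p, b*d+b)) else 0)"
    by (intro sum.cong refl) simp
  finally show ?thesis by simp
qed

lemma feas_entangled_bound:
  assumes "\<Omega> \<in> carrier_mat (d*d) (d*d)" "t \<in> feas d d \<Omega>"
  shows "Re (\<Sum>a<d. \<Sum>b<d. \<Omega> $$ (a*d+a, b*d+b)) \<le> t"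
proof -
  obtain Y where t: "t = Re (mtrace Y)" and Y: "psd d Y" and psd: "psd (d*d) (kron (1\<^sub>m d) Y - \<Omega>)"
    using assms(2) by (auto simp: feas_def)
  note Yc = psd_carrier[OF Y]
  let ?w = "\<lambda>i. if i div d = i mod d then 1 else (0::complex)"
  have "0 \<le> sesq (d*d) (($$) (kron (1\<^sub>m d) Y - \<Omega>)) ?w ?w"
    using psd unfolding psd_iff psd_fun_def by blast
  also have "\<dots> = (\<Sum>a<d. \<Sum>b<d. (if b = a then Y $$ (a,b) else 0) - \<Omega> $$ (a*d+a, b*d+b))"
    unfolding sesq_entangled using Yc assms(1) mult_add_less[of _ d _ d]
    by (intro sum.cong refl) (auto simp: kron_index[of _ d _ d])
  also have "\<dots> = mtrace Y - (\<Sum>a<d. \<Sum>b<d. \<Omega> $$ (a*d+a, b*d+b))"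
    using Yc by (simp add: sum_subtractf mtrace_carrier)
  finally show ?thesis by (simp add: t less_eq_complex_def)
qed

locale dual_rep = haar_group +
  fixes d m :: nat and UB UX :: "'a::t2_space \<Rightarrow> complex mat"
  assumes rep_UB: "unitary_rep gmul d UB" and rep_UX: "unitary_rep gmul m UX"
begin

sublocale X: rep gmul e ginv \<mu> m UX
  by unfold_locales (rule rep_UX)

sublocale RX: rep gmul e ginv \<mu> "d*m" "\<lambda>g. kron (cconj_mat (UB g)) (UX g)"
  by unfold_locales (intro unitary_rep_kron unitary_rep_cconj rep_UB rep_UX)

lemma UB_carrier[simp]: "UB g \<in> carrier_mat d d"
  using rep_UB by (auto simp: unitary_rep_def unitary_def)

abbreviation dconj where "dconj g \<eta> \<equiv> cconj_mat (UB g) * \<eta> * dagger (cconj_mat (UB g))"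

lemma conj_kron:
  assumes "\<eta> \<in> carrier_mat d d" "\<tau> \<in> carrier_mat m m"
  shows "RX.conj g (kron \<eta> \<tau>) = kron (dconj g \<eta>) (X.conj g \<tau>)"
  using assms by (simp add: dagger_kron[of _ d _ m] kron_mult[of _ d _ m])

lemma dconj_one: "dconj g (1\<^sub>m d) = 1\<^sub>m d"
  using unitary_rep_cconj[OF rep_UB] by (simp add: unitary_rep_def unitary_def right_mult_one_mat[of _ d d])

lemma tw_kron_one:
  assumes "\<tau> \<in> carrier_mat m m"
  shows "RX.tw (kron (1\<^sub>m d) \<tau>) = kron (1\<^sub>m d) (X.tw \<tau>)"
proof (rule eq_mat_blockI[of _ d m])
  fix a p b q assume i: "a < d" "p < m" "b < d" "q < m"
  have "RX.conj g (kron (1\<^sub>m d) \<tau>) $$ (a*m+p, b*m+q) = 1\<^sub>m d $$ (a,b) * X.conj g \<tau> $$ (p,q)" for g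
    using assms i by (simp only: conj_kron dconj_one one_carrier_mat kron_index[of _ d _ m] X.conj_carrier)
  thus "RX.tw (kron (1\<^sub>m d) \<tau>) $$ (a*m+p, b*m+q) = kron (1\<^sub>m d) (X.tw \<tau>) $$ (a*m+p, b*m+q)"
    using i mult_add_less[OF i(1,2)] mult_add_less[OF i(3,4)]
    by (simp add: RX.tw_index kron_index[of _ d _ m] X.tw_index)
qed auto

abbreviation mval where "mval \<eta> \<tau> \<equiv> Inf (feas d m (RX.tw (kron \<eta> \<tau>)))"

lemma trace_tw_kron:
  assumes "density d \<eta>" "density m \<tau>"
  shows "mtrace (RX.tw (kron \<eta> \<tau>)) = 1"
  using assms by (simp add: density_def psd_iff RX.mtrace_tw mtrace_kron[of _ d _ m])

lemma feas_lower:
  assumes "density d \<eta>" "density m \<tau>" "d > 0" "t \<in> feas d m (RX.tw (kron \<eta> \<tau>))"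
  shows "1 / d \<le> t"
  using feas_trace_bound[OF RX.tw_carrier assms(4,3)] by (simp add: trace_tw_kron[OF assms(1,2)])

lemma feas_bdd_below:
  assumes "density d \<eta>" "density m \<tau>" "d > 0"
  shows "bdd_below (feas d m (RX.tw (kron \<eta> \<tau>)))"
  using feas_lower[OF assms] by (auto simp: bdd_below_def)

lemma feas_nonempty:
  assumes "density d \<eta>" "density m \<tau>"
  shows "feas d m (RX.tw (kron \<eta> \<tau>)) \<noteq> {}"
proof -
  have E: "\<eta> \<in> carrier_mat d d" "psd_fun d (($$) \<eta>)" and T: "\<tau> \<in> carrier_mat m m" "psd m \<tau>"
    using assms by (auto simp: density_def psd_iff)
  define c where "c = (\<Sum>i<d. \<Sum>j<d. cmod ((- \<eta>) $$ (i,j)))"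
  have c0: "0 \<le> c" by (auto simp: c_def intro!: sum_nonneg)
  have "psd d (of_real c \<cdot>\<^sub>m 1\<^sub>m d + - \<eta>)"
  proof (rule psd_diag_dominant)
    fix i j assume ij: "i < d" "j < d"
    have "\<eta> $$ (j,i) = cnj (\<eta> $$ (i,j))" using psd_fun_hermitian[OF E(2) ij] .
    thus "(- \<eta>) $$ (j,i) = cnj ((- \<eta>) $$ (i,j))" using E(1) ij by simp
  qed (use E in \<open>auto simp: c_def\<close>)
  moreover have "of_real c \<cdot>\<^sub>m 1\<^sub>m d + - \<eta> = of_real c \<cdot>\<^sub>m 1\<^sub>m d - \<eta>"
    using E by (intro eq_matI) auto
  ultimately have "psd (d*m) (kron (of_real c \<cdot>\<^sub>m 1\<^sub>m d - \<eta>) \<tau>)"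
    using T by (intro psd_kron) auto
  hence "psd (d*m) (kron (1\<^sub>m d) (of_real c \<cdot>\<^sub>m \<tau>) - kron \<eta> \<tau>)"
    using E T by (simp add: kron_minus_left[of _ d _ _ m] kron_smult_left[of _ d _ m])
  from RX.psd_tw[OF this] have "psd (d*m) (kron (1\<^sub>m d) (X.tw (of_real c \<cdot>\<^sub>m \<tau>)) - RX.tw (kron \<eta> \<tau>))"
    using E T by (simp add: RX.tw_minus tw_kron_one)
  moreover have "psd m (X.tw (of_real c \<cdot>\<^sub>m \<tau>))"
    using T c0 by (intro X.psd_tw psd_smult)
  ultimately show ?thesis by (auto simp: feas_def)
qed

lemma mval_lower:
  assumes "density d \<eta>" "density m \<tau>" "d > 0"
  shows "1 / d \<le> mval \<eta> \<tau>"
  using feas_lower[OF assms] feas_nonempty[OF assms(1,2)] by (intro cInf_greatest)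

lemma mval_pos:
  assumes "density d \<eta>" "density m \<tau>" "d > 0"
  shows "0 < mval \<eta> \<tau>"
  using mval_lower[OF assms] assms(3) by (smt (verit) divide_pos_pos of_nat_0_less_iff zero_less_one)

lemma density_mixed:
  assumes "d > 0"
  shows "density d ((1 / of_nat d) \<cdot>\<^sub>m 1\<^sub>m d)"
proof -
  have "psd d (of_real (1 / d) \<cdot>\<^sub>m 1\<^sub>m d)"
    by (intro psd_smult) (auto simp: psd_iff psd_fun_def sesq_one less_eq_complex_def intro: sum_nonneg)
  thus ?thesis using assms by (simp add: density_def mtrace_smult[of _ d] mtrace_one)
qed

lemma mval_mixed:
  assumes "density m \<tau>" "d > 0"
  shows "mval ((1 / of_nat d) \<cdot>\<^sub>m 1\<^sub>m d) \<tau> = 1 / d"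
proof (rule antisym)
  have T: "\<tau> \<in> carrier_mat m m" "psd m \<tau>" "mtrace \<tau> = 1" using assms by (auto simp: density_def psd_iff)
  let ?Y = "X.tw (of_real (1 / d) \<cdot>\<^sub>m \<tau>)"
  have eq: "RX.tw (kron ((1 / of_nat d) \<cdot>\<^sub>m 1\<^sub>m d) \<tau>) = kron (1\<^sub>m d) ?Y"
    using T(1) by (simp add: kron_smult_left[of _ d _ m] tw_kron_one)
  have "psd (d*m) (kron (1\<^sub>m d) ?Y - kron (1\<^sub>m d) ?Y)"
    by (simp only: minus_r_inv_mat[OF kron_carrier[OF one_carrier_mat X.tw_carrier]] psd_zero)
  moreover have "psd m ?Y" using T by (intro X.psd_tw psd_smult) auto
  moreover have "Re (mtrace ?Y) = 1 / d" using T by (simp add: X.mtrace_tw mtrace_smult[of _ m])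
  ultimately have "1 / d \<in> feas d m (RX.tw (kron ((1 / of_nat d) \<cdot>\<^sub>m 1\<^sub>m d) \<tau>))"
    unfolding eq feas_def by (intro CollectI exI[of _ ?Y]) auto
  thus "mval ((1 / of_nat d) \<cdot>\<^sub>m 1\<^sub>m d) \<tau> \<le> 1 / d"
    by (intro cInf_lower feas_bdd_below density_mixed assms)
qed (intro mval_lower density_mixed assms)

lemma Heta_mval: "Heta \<mu> (\<lambda>g. cconj_mat (UB g)) d UX m \<eta> \<tau> = - log 2 (mval \<eta> \<tau>)"
  by (simp add: Heta_def hmin_feas)

end

lemma (in dual_rep) mval_entangled_bound:
  assumes "m = d" "UX = UB" "density d \<eta>" "density d \<tau>"
  shows "Re (\<Sum>a<d. \<Sum>b<d. \<eta> $$ (a,b) * \<tau> $$ (a,b)) \<le> mval \<eta> \<tau>"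
proof (rule cInf_greatest)
  show "feas d m (RX.tw (kron \<eta> \<tau>)) \<noteq> {}" using assms by (intro feas_nonempty) auto
  fix t assume t: "t \<in> feas d m (RX.tw (kron \<eta> \<tau>))"
  let ?w = "\<lambda>i. if i div d = i mod d then 1 else (0::complex)"
  let ?M = "kron \<eta> \<tau>"
  have c: "\<eta> \<in> carrier_mat d d" "\<tau> \<in> carrier_mat d d" using assms by (auto simp: density_def psd_iff)
  hence M: "?M \<in> carrier_mat (d*d) (d*d)" by simp
  have w: "?w (a*d+p) = (if p = a then 1 else 0)" if "p < d" for a p using that by simp
  have inv: "(\<Sum>i<d*d. cnj (kron (cconj_mat (UB g)) (UB g) $$ (i,k)) * ?w i) = ?w k" if k: "k < d*d" for g k
  proof -
    obtain c r where k: "k = c*d+r" "c < d" "r < d" using div_mod_less[OF k] by metis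
    have "(\<Sum>i<d*d. cnj (kron (cconj_mat (UB g)) (UB g) $$ (i,k)) * ?w i)
      = (\<Sum>a<d. \<Sum>p<d. cnj (kron (cconj_mat (UB g)) (UB g) $$ (a*d+p,c*d+r)) * ?w (a*d+p))"
      unfolding sum_lessThan_mult k(1) ..
    also have "\<dots> = (\<Sum>a<d. \<Sum>p<d. if p = a then UB g $$ (a,c) * cnj (UB g $$ (p,r)) else 0)"
      using k by (intro sum.cong refl)
        (simp add: w kron_index[of _ d _ d] cconj_mat_index[of _ d d] del: div_mult_self3 mod_mult_self3)
    also have "\<dots> = (dagger (UB g) * UB g) $$ (r,c)"
      using k by (simp add: mult_index[of _ d d _ d] dagger_index[of _ d d] mult.commute)
    also have "dagger (UB g) * UB g = 1\<^sub>m d"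
      using rep_UB by (auto simp: unitary_rep_def intro!: unitary_left)
    finally show ?thesis using k by auto
  qed
  have "sesq (d*d) (($$) (RX.conj g ?M)) ?w ?w = sesq (d*d) (($$) ?M) ?w ?w" for g
  proof -
    let ?W = "kron (cconj_mat (UB g)) (UB g)"
    have "sesq (d*d) (($$) (RX.conj g ?M)) ?w ?w
      = sesq (d*d) (($$) ?M) (\<lambda>k. \<Sum>i<d*d. cnj (?W $$ (i,k)) * ?w i) (\<lambda>k. \<Sum>i<d*d. cnj (?W $$ (i,k)) * ?w i)"
      unfolding assms(2) by (intro sesq_conj M kron_carrier cconj_mat_carrier UB_carrier)
    also have "\<dots> = sesq (d*d) (($$) ?M) ?w ?w"
      by (intro sesq_cong inv refl)
    finally show ?thesis .
  qed
  hence "sesq (d*d) (($$) (RX.tw ?M)) ?w ?w = sesq (d*d) (($$) ?M) ?w ?w"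
    using RX.sesq_tw[of ?M ?w ?w] M assms(1,2) by (simp add: measure_haar)
  hence "(\<Sum>a<d. \<Sum>b<d. RX.tw ?M $$ (a*d+a, b*d+b)) = (\<Sum>a<d. \<Sum>b<d. ?M $$ (a*d+a, b*d+b))"
    unfolding sesq_entangled .
  also have "\<dots> = (\<Sum>a<d. \<Sum>b<d. \<eta> $$ (a,b) * \<tau> $$ (a,b))"
    using c by (intro sum.cong refl) (simp add: kron_index[of _ d _ d])
  finally show "Re (\<Sum>a<d. \<Sum>b<d. \<eta> $$ (a,b) * \<tau> $$ (a,b)) \<le> t"
    using feas_entangled_bound[of "RX.tw ?M" d t] t RX.tw_carrier[of ?M] assms(1) by simp
qed

section \<open>Covariant channels\<close>

definition unit_mat :: "nat \<Rightarrow> nat \<times> nat \<Rightarrow> complex mat" where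
  "unit_mat d k = mat d d (\<lambda>ij. if ij = k then 1 else 0)"

lemma linear_map_expand:
  fixes E :: "complex mat \<Rightarrow> complex mat"
  assumes carrier: "\<And>X. X \<in> carrier_mat d d \<Longrightarrow> E X \<in> carrier_mat k k"
    and add: "\<And>X Y. X \<in> carrier_mat d d \<Longrightarrow> Y \<in> carrier_mat d d \<Longrightarrow> E (X + Y) = E X + E Y"
    and smult: "\<And>X c. X \<in> carrier_mat d d \<Longrightarrow> E (c \<cdot>\<^sub>m X) = c \<cdot>\<^sub>m E X"
    and X: "X \<in> carrier_mat d d" and pq: "p < k" "q < k"
  shows "E X $$ (p,q) = (\<Sum>r<d. \<Sum>s<d. X $$ (r,s) * E (unit_mat d (r,s)) $$ (p,q))"
proof -
  define P where "P = (\<lambda>S. mat d d (\<lambda>ij. if ij \<in> S then X $$ ij else 0))"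
  have P: "P S \<in> carrier_mat d d" for S by (simp add: P_def)
  have U: "unit_mat d rs \<in> carrier_mat d d" for rs by (simp add: unit_mat_def)
  have "E (P S) $$ (p,q) = (\<Sum>rs\<in>S. X $$ rs * E (unit_mat d rs) $$ (p,q))" if "finite S" for S
    using that
  proof induction
    case empty
    have "P {} = 0 \<cdot>\<^sub>m P {}" by (rule eq_matI) (auto simp: P_def)
    hence "E (P {}) = 0 \<cdot>\<^sub>m E (P {})" using smult[OF P] by metis
    moreover have "(0 \<cdot>\<^sub>m E (P {})) $$ (p,q) = 0" using carrier[OF P[of "{}"]] pq by simp
    ultimately show ?case by simp
  next
    case (insert rs S)
    have "P (insert rs S) = P S + X $$ rs \<cdot>\<^sub>m unit_mat d rs"
      using insert.hyps by (intro eq_matI) (auto simp: P_def unit_mat_def)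
    hence "E (P (insert rs S)) = E (P S) + X $$ rs \<cdot>\<^sub>m E (unit_mat d rs)"
      using add[OF P smult_carrier_mat[OF U]] smult[OF U] by simp
    thus ?case using insert carrier[OF P[of S]] carrier[OF U[of rs]] pq by simp
  qed
  from this[of "{..<d} \<times> {..<d}"] have "E (P ({..<d} \<times> {..<d})) $$ (p,q)
     = (\<Sum>r<d. \<Sum>s<d. X $$ (r,s) * E (unit_mat d (r,s)) $$ (p,q))"
    by (simp add: sum.cartesian_product case_prod_unfold)
  moreover have "P ({..<d} \<times> {..<d}) = X" using X by (intro eq_matI) (auto simp: P_def)
  ultimately show ?thesis by simp
qed

lemma blk_carrier[simp]: "blk d M a b \<in> carrier_mat d d"
  by (simp add: blk_def)

lemma id_tensor_carrier[simp]: "id_tensor k dA dB E M \<in> carrier_mat (k*dB) (k*dB)"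
  by (simp add: id_tensor_def)

lemma id_tensor_index:
  assumes "a < k" "p < dB" "b < k" "q < dB"
  shows "id_tensor k dA dB E M $$ (a*dB+p, b*dB+q) = E (blk dA M a b) $$ (p,q)"
  using assms by (simp add: id_tensor_def mult_add_less)

lemma channel_minus:
  assumes "channel dA dB E" "X \<in> carrier_mat dA dA" "Y \<in> carrier_mat dA dA"
  shows "E (X - Y) = E X - E Y"
proof -
  have E: "E X \<in> carrier_mat dB dB" "E Y \<in> carrier_mat dB dB"
    using assms by (auto simp: channel_def)
  have "X - Y = X + (-1) \<cdot>\<^sub>m Y" using assms by (intro eq_matI) auto
  hence "E (X - Y) = E X + (-1) \<cdot>\<^sub>m E Y" using assms by (simp add: channel_def)
  also have "\<dots> = E X - E Y" using E by (intro eq_matI) auto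
  finally show ?thesis .
qed

lemma id_tensor_minus:
  assumes "channel dA dB E" "M \<in> carrier_mat (k*dA) (k*dA)" "N \<in> carrier_mat (k*dA) (k*dA)"
  shows "id_tensor k dA dB E (M - N) = id_tensor k dA dB E M - id_tensor k dA dB E N"
proof (rule eq_mat_blockI[of _ k dB])
  fix a p b q assume i: "a < k" "p < dB" "b < k" "q < dB"
  have "blk dA (M - N) a b = blk dA M a b - blk dA N a b"
    using assms(2,3) i by (intro eq_matI) (auto simp: blk_def mult_add_less)
  hence "E (blk dA (M - N) a b) = E (blk dA M a b) - E (blk dA N a b)"
    by (simp add: channel_minus[OF assms(1)])
  moreover have "E (blk dA N a b) \<in> carrier_mat dB dB" using assms(1) by (simp add: channel_def)
  ultimately show "id_tensor k dA dB E (M - N) $$ (a*dB+p, b*dB+q)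
      = (id_tensor k dA dB E M - id_tensor k dA dB E N) $$ (a*dB+p, b*dB+q)"
    using i by (simp add: id_tensor_index mult_add_less carrier_matD[OF id_tensor_carrier])
qed (auto simp: minus_carrier_mat)

lemma id_tensor_kron:
  assumes "channel dA dB E" "\<eta> \<in> carrier_mat k k" "Y \<in> carrier_mat dA dA"
  shows "id_tensor k dA dB E (kron \<eta> Y) = kron \<eta> (E Y)"
proof (rule eq_mat_blockI[of _ k dB])
  have EY: "E Y \<in> carrier_mat dB dB" using assms by (simp add: channel_def)
  thus "kron \<eta> (E Y) \<in> carrier_mat (k*dB) (k*dB)" using assms by simp
  fix a p b q assume i: "a < k" "p < dB" "b < k" "q < dB"
  have "blk dA (kron \<eta> Y) a b = \<eta> $$ (a,b) \<cdot>\<^sub>m Y"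
    using assms i by (intro eq_matI) (auto simp: blk_def kron_index[of _ k _ dA])
  hence "E (blk dA (kron \<eta> Y) a b) = \<eta> $$ (a,b) \<cdot>\<^sub>m E Y"
    using assms by (simp add: channel_def)
  thus "id_tensor k dA dB E (kron \<eta> Y) $$ (a*dB+p, b*dB+q) = kron \<eta> (E Y) $$ (a*dB+p, b*dB+q)"
    using i EY assms by (simp add: id_tensor_index kron_index[of _ k _ dB])
qed simp

lemma channel_psd:
  assumes "channel dA dB E" "psd dA Y"
  shows "psd dB (E Y)"
proof -
  have Y: "Y \<in> carrier_mat dA dA" using assms by (simp add: psd_def)
  have one: "kron (1\<^sub>m 1) A = A" for A :: "complex mat"
    by (intro eq_matI) (auto simp: kron_def)
  have "id_tensor 1 dA dB E Y = E Y"
    using id_tensor_kron[OF assms(1) one_carrier_mat Y, of 1] by (simp only: one)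
  moreover have cp: "\<forall>k M. psd (k*dA) M \<longrightarrow> psd (k*dB) (id_tensor k dA dB E M)"
    using assms(1) by (simp add: channel_def)
  from cp[rule_format, of 1 Y] have "psd dB (id_tensor 1 dA dB E Y)"
    using assms(2) by (simp del: One_nat_def)
  ultimately show ?thesis by simp
qed

locale two_reps = haar_group +
  fixes dA dB :: nat and UA UB :: "'a::t2_space \<Rightarrow> complex mat"
  assumes rep_UA: "unitary_rep gmul dA UA" and rep_UB: "unitary_rep gmul dB UB"
begin

sublocale A: dual_rep gmul e ginv \<mu> dB dA UB UA
  by unfold_locales (rule rep_UB rep_UA)+

sublocale B: dual_rep gmul e ginv \<mu> dB dB UB UB
  by unfold_locales (rule rep_UB)+

lemma id_tensor_tw:
  assumes E: "channel dA dB E" and cov: "covariant dA UA UB E"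
    and \<eta>: "\<eta> \<in> carrier_mat dB dB" and \<rho>: "\<rho> \<in> carrier_mat dA dA"
  shows "id_tensor dB dA dB E (A.RX.tw (kron \<eta> \<rho>)) = B.RX.tw (kron \<eta> (E \<rho>))"
proof (rule eq_mat_blockI[of _ dB dB])
  have E\<rho>: "E \<rho> \<in> carrier_mat dB dB" using E \<rho> by (simp add: channel_def)
  fix a p b q assume i: "a < dB" "p < dB" "b < dB" "q < dB"
  define K where "K = (\<lambda>r s. E (unit_mat dA (r,s)) $$ (p,q))"
  have expand: "E X $$ (p,q) = (\<Sum>r<dA. \<Sum>s<dA. X $$ (r,s) * K r s)" if "X \<in> carrier_mat dA dA" for X
    unfolding K_def using E that i by (intro linear_map_expand[where d = dA and k = dB]) (auto simp: channel_def)
  define f where "f = (\<lambda>r s g. A.RX.conj g (kron \<eta> \<rho>) $$ (a*dA+r, b*dA+s) * K r s)"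
  have f: "f r s g = A.dconj g \<eta> $$ (a,b) * (A.X.conj g \<rho> $$ (r,s) * K r s)" if "r < dA" "s < dA" for r s g
    using \<eta> \<rho> i that by (simp only: f_def A.conj_kron kron_index[of _ dB _ dA] A.X.conj_carrier mult.assoc
      mult_carrier_square dagger_carrier cconj_mat_carrier A.UB_carrier)
  have int: "integrable \<mu> (f r s)" if "r < dA" "s < dA" for r s
    unfolding f_def using i that \<eta> \<rho>
    by (intro integrable_mult_left A.RX.integrable_conj) (auto simp: mult_add_less)
  have "E (blk dA (A.RX.tw (kron \<eta> \<rho>)) a b) $$ (p,q)
      = (\<Sum>r<dA. \<Sum>s<dA. A.RX.tw (kron \<eta> \<rho>) $$ (a*dA+r, b*dA+s) * K r s)"
    by (simp add: expand blk_def)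
  also have "\<dots> = (\<Sum>r<dA. \<Sum>s<dA. \<integral>g. f r s g \<partial>\<mu>)"
    using i by (intro sum.cong refl) (simp add: A.RX.tw_index mult_add_less f_def)
  also have "\<dots> = (\<Sum>r<dA. \<integral>g. (\<Sum>s<dA. f r s g) \<partial>\<mu>)"
    using int by (intro sum.cong refl Bochner_Integration.integral_sum[symmetric]) auto
  also have "\<dots> = (\<integral>g. (\<Sum>r<dA. \<Sum>s<dA. f r s g) \<partial>\<mu>)"
    using int by (intro Bochner_Integration.integral_sum[symmetric] integrable_sum) auto
  also have "(\<lambda>g. \<Sum>r<dA. \<Sum>s<dA. f r s g) = (\<lambda>g. A.dconj g \<eta> $$ (a,b) * E (A.X.conj g \<rho>) $$ (p,q))"
    using \<rho> by (simp add: f expand sum_distrib_left)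
  also have "\<dots> = (\<lambda>g. A.dconj g \<eta> $$ (a,b) * B.X.conj g (E \<rho>) $$ (p,q))"
    using cov \<rho> by (simp add: covariant_def)
  also have "\<dots> = (\<lambda>g. B.RX.conj g (kron \<eta> (E \<rho>)) $$ (a*dB+p, b*dB+q))"
    using \<eta> E\<rho> i by (simp only: B.conj_kron kron_index[of _ dB _ dB] B.X.conj_carrier
      mult_carrier_square dagger_carrier cconj_mat_carrier A.UB_carrier)
  finally show "id_tensor dB dA dB E (A.RX.tw (kron \<eta> \<rho>)) $$ (a*dB+p, b*dB+q)
      = B.RX.tw (kron \<eta> (E \<rho>)) $$ (a*dB+p, b*dB+q)"
    using i by (simp add: id_tensor_index B.RX.tw_index mult_add_less)
qed auto

lemma mval_mono:
  assumes E: "channel dA dB E" and cov: "covariant dA UA UB E"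
    and \<eta>: "density dB \<eta>" and \<rho>: "density dA \<rho>" and \<sigma>: "density dB (E \<rho>)" and "dB > 0"
  shows "B.mval \<eta> (E \<rho>) \<le> A.mval \<eta> \<rho>"
proof (rule cInf_superset_mono)
  show "feas dB dA (A.RX.tw (kron \<eta> \<rho>)) \<noteq> {}" by (rule A.feas_nonempty[OF \<eta> \<rho>])
  show "bdd_below (feas dB dB (B.RX.tw (kron \<eta> (E \<rho>))))" by (rule B.feas_bdd_below[OF \<eta> \<sigma> \<open>dB > 0\<close>])
  have c: "\<eta> \<in> carrier_mat dB dB" "\<rho> \<in> carrier_mat dA dA" using \<eta> \<rho> by (auto simp: density_def psd_iff)
  show "feas dB dA (A.RX.tw (kron \<eta> \<rho>)) \<subseteq> feas dB dB (B.RX.tw (kron \<eta> (E \<rho>)))"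
  proof
    fix t assume "t \<in> feas dB dA (A.RX.tw (kron \<eta> \<rho>))"
    then obtain Y where Y: "t = Re (mtrace Y)" "psd dA Y"
      and le: "psd (dB*dA) (kron (1\<^sub>m dB) Y - A.RX.tw (kron \<eta> \<rho>))" by (auto simp: feas_def)
    have Yc: "Y \<in> carrier_mat dA dA" using Y by (simp add: psd_def)
    have "psd (dB*dB) (id_tensor dB dA dB E (kron (1\<^sub>m dB) Y - A.RX.tw (kron \<eta> \<rho>)))"
      using E le by (simp add: channel_def)
    also have "id_tensor dB dA dB E (kron (1\<^sub>m dB) Y - A.RX.tw (kron \<eta> \<rho>))
      = kron (1\<^sub>m dB) (E Y) - B.RX.tw (kron \<eta> (E \<rho>))"
      using Yc c by (simp add: id_tensor_minus[OF E] id_tensor_kron[OF E] id_tensor_tw[OF E cov])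
    finally have "psd (dB*dB) (kron (1\<^sub>m dB) (E Y) - B.RX.tw (kron \<eta> (E \<rho>)))" .
    moreover have "psd dB (E Y)" by (rule channel_psd[OF E Y(2)])
    moreover have "t = Re (mtrace (E Y))" using E Yc Y(1) by (simp add: channel_def)
    ultimately show "t \<in> feas dB dB (B.RX.tw (kron \<eta> (E \<rho>)))" unfolding feas_def by blast
  qed
qed

end

definition choi_map :: "nat \<Rightarrow> nat \<Rightarrow> (nat \<times> nat \<Rightarrow> complex) \<Rightarrow> complex mat \<Rightarrow> complex mat" where
  "choi_map dA dB J X = mat dB dB (\<lambda>(b,a). \<Sum>p<dA. \<Sum>q<dA. J (a*dA+p, b*dA+q) * X $$ (q,p))"

lemma choi_map_carrier[simp]: "choi_map dA dB J X \<in> carrier_mat dB dB"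
  by (simp add: choi_map_def)

lemma choi_map_index:
  "b < dB \<Longrightarrow> a < dB \<Longrightarrow> choi_map dA dB J X $$ (b,a) = (\<Sum>p<dA. \<Sum>q<dA. J (a*dA+p, b*dA+q) * X $$ (q,p))"
  by (simp add: choi_map_def)

lemma sum_regroup_choi:
  fixes f :: "_ \<Rightarrow> _ \<Rightarrow> _ \<Rightarrow> _ \<Rightarrow> _ \<Rightarrow> _ \<Rightarrow> _ \<Rightarrow> 'a :: comm_monoid_add"
  shows "(\<Sum>x\<in>X. \<Sum>b\<in>B. \<Sum>y\<in>Y. \<Sum>a\<in>A. \<Sum>p\<in>P. \<Sum>q\<in>Q. \<Sum>l\<in>L. f x b y a p q l)
    = (\<Sum>l\<in>L. \<Sum>x\<in>X. \<Sum>q\<in>Q. \<Sum>y\<in>Y. \<Sum>p\<in>P. \<Sum>b\<in>B. \<Sum>a\<in>A. f x b y a p q l)"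
  by (simp only: sum.swap[of _ L] sum.swap[of _ Q B] sum.swap[of _ Y B] sum.swap[of _ P B]
      sum.swap[of _ P A] sum.swap[of _ Q A] sum.swap[of _ Q Y] sum.swap[of _ Q P])

lemma psd_id_tensor_choi_map:
  assumes J: "psd_fun (dB*dA) J" and M: "psd (k*dA) M"
  shows "psd (k*dB) (id_tensor k dA dB (choi_map dA dB J) M)"
proof -
  obtain z where z: "\<And>i j. i < dB*dA \<Longrightarrow> j < dB*dA \<Longrightarrow> J (i,j) = (\<Sum>l<dB*dA. z l i * cnj (z l j))"
    using psd_fun_factor[OF J] by blast
  let ?L = "{..<dB*dA}"
  have "0 \<le> sesq (k*dB) (($$) (id_tensor k dA dB (choi_map dA dB J) M)) w w" for w
  proof -
    define u where "u = (\<lambda>l i. \<Sum>b<dB. z l (b*dA + i mod dA) * w (i div dA * dB + b))"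
    have u: "u l (x*dA+q) = (\<Sum>b<dB. z l (b*dA+q) * w (x*dB+b))" if "q < dA" for l x q
      using that by (simp add: u_def)
    have ent: "id_tensor k dA dB (choi_map dA dB J) M $$ (x*dB+b, y*dB+a)
      = (\<Sum>p<dA. \<Sum>q<dA. \<Sum>l\<in>?L. z l (a*dA+p) * cnj (z l (b*dA+q)) * M $$ (x*dA+q, y*dA+p))"
      if "x < k" "b < dB" "y < k" "a < dB" for x b y a
      unfolding id_tensor_index[OF that] choi_map_index[OF that(2,4)]
      using that by (intro sum.cong refl) (simp add: z mult_add_less blk_def sum_distrib_right)
    have "sesq (k*dB) (($$) (id_tensor k dA dB (choi_map dA dB J) M)) w w
      = (\<Sum>x<k. \<Sum>b<dB. \<Sum>y<k. \<Sum>a<dB. \<Sum>p<dA. \<Sum>q<dA. \<Sum>l\<in>?L.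
          cnj (w (x*dB+b)) * (z l (a*dA+p) * cnj (z l (b*dA+q)) * M $$ (x*dA+q, y*dA+p)) * w (y*dB+a))"
      unfolding sesq_mult
      by (intro sum.cong refl) (simp only: ent lessThan_iff sum_distrib_left sum_distrib_right)
    also have "\<dots> = (\<Sum>l\<in>?L. \<Sum>x<k. \<Sum>q<dA. \<Sum>y<k. \<Sum>p<dA. \<Sum>b<dB. \<Sum>a<dB.
          cnj (w (x*dB+b)) * (z l (a*dA+p) * cnj (z l (b*dA+q)) * M $$ (x*dA+q, y*dA+p)) * w (y*dB+a))"
      by (rule sum_regroup_choi)
    also have "\<dots> = (\<Sum>l\<in>?L. sesq (k*dA) (($$) M) (u l) (u l))"
      unfolding sesq_mult
      by (intro sum.cong refl) (simp only: u lessThan_iff cnj_sum sum_sandwich, simp add: mult_ac)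
    also have "\<dots> \<ge> 0"
      using M unfolding psd_iff psd_fun_def by (intro sum_nonneg) blast
    finally show ?thesis .
  qed
  thus ?thesis by (simp add: psd_iff psd_fun_def)
qed

lemma channel_choi_map:
  assumes J: "psd_fun (dB*dA) J"
    and tr: "\<And>p q. p < dA \<Longrightarrow> q < dA \<Longrightarrow> (\<Sum>a<dB. J (a*dA+p, a*dA+q)) = (if p = q then 1 else 0)"
  shows "channel dA dB (choi_map dA dB J)"
  unfolding channel_def
proof (intro conjI ballI allI impI)
  fix X Y :: "complex mat" and c :: complex assume X: "X \<in> carrier_mat dA dA"
  show "choi_map dA dB J (X + Y) = choi_map dA dB J X + choi_map dA dB J Y" if "Y \<in> carrier_mat dA dA"
    using X that by (intro eq_matI) (auto simp: choi_map_def distrib_left sum.distrib)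
  show "choi_map dA dB J (c \<cdot>\<^sub>m X) = c \<cdot>\<^sub>m choi_map dA dB J X"
    using X by (intro eq_matI) (auto simp: choi_map_def sum_distrib_left mult_ac)
  have "mtrace (choi_map dA dB J X) = (\<Sum>a<dB. \<Sum>p<dA. \<Sum>q<dA. J (a*dA+p, a*dA+q) * X $$ (q,p))"
    by (simp add: mtrace_carrier[of _ dB] choi_map_index)
  also have "\<dots> = (\<Sum>p<dA. \<Sum>q<dA. \<Sum>a<dB. J (a*dA+p, a*dA+q) * X $$ (q,p))"
    by (subst sum.swap) (intro sum.cong refl sum.swap)
  also have "\<dots> = (\<Sum>p<dA. \<Sum>q<dA. if q = p then X $$ (q,p) else 0)"
    by (intro sum.cong refl) (simp add: tr flip: sum_distrib_right)
  finally show "mtrace (choi_map dA dB J X) = mtrace X" using X by (simp add: mtrace_carrier)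
next
  fix k M assume "psd (k*dA) M"
  thus "psd (k*dB) (id_tensor k dA dB (choi_map dA dB J) M)" by (rule psd_id_tensor_choi_map[OF J])
qed simp

lemma (in two_reps) covariant_choi_map:
  assumes J: "J \<in> carrier_mat (dB*dA) (dB*dA)" and inv: "\<And>g. A.RX.conj g J = J"
  shows "covariant dA UA UB (choi_map dA dB (($$) J))"
  unfolding covariant_def
proof (intro allI ballI)
  fix g and X :: "complex mat" assume X: "X \<in> carrier_mat dA dA"
  let ?E = "choi_map dA dB (($$) J)" and ?X = "UA g * X * dagger (UA g)"
  have UA: "UA g \<in> carrier_mat dA dA" and UB: "UB g \<in> carrier_mat dB dB" by simp_all
  have Xc: "?X \<in> carrier_mat dA dA" using X by simp
  have undo: "(\<Sum>p<dA. \<Sum>q<dA. cnj (UA g $$ (q,q')) * UA g $$ (p,p') * ?X $$ (q,p)) = X $$ (q',p')"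
    if "p' < dA" "q' < dA" for p' q'
  proof -
    have "dagger (UA g) * ?X * UA g = (dagger (UA g) * UA g) * X * (dagger (UA g) * UA g)"
      using X by (simp add: assoc_mult_mat[of _ dA dA _ dA _ dA])
    also have "\<dots> = X" using X by (simp add: A.X.V_left)
    finally have "X $$ (q',p') = (dagger (UA g) * ?X * dagger (dagger (UA g))) $$ (q',p')"
      by (simp only: dagger_dagger)
    also have "\<dots> = (\<Sum>q<dA. \<Sum>p<dA. dagger (UA g) $$ (q',q) * cnj (dagger (UA g) $$ (p',p)) * ?X $$ (q,p))"
      using that by (intro conj_index[OF dagger_carrier[OF UA] Xc])
    also have "\<dots> = (\<Sum>q<dA. \<Sum>p<dA. cnj (UA g $$ (q,q')) * UA g $$ (p,p') * ?X $$ (q,p))"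
      using that by (intro sum.cong refl) (simp add: dagger_index[OF UA])
    finally show ?thesis by (subst sum.swap) simp
  qed
  show "?E ?X = UB g * ?E X * dagger (UB g)"
  proof (rule eq_matI)
    fix b a assume "b < dim_row (UB g * ?E X * dagger (UB g))" "a < dim_col (UB g * ?E X * dagger (UB g))"
    hence i: "b < dB" "a < dB" using UB by (auto simp: dagger_def)
    let ?t = "\<lambda>p q a' p' b' q'. (cnj (UB g $$ (a,a')) * UA g $$ (p,p')) * (UB g $$ (b,b') * cnj (UA g $$ (q,q')))
        * J $$ (a'*dA+p', b'*dA+q') * ?X $$ (q,p)"
    have ent: "J $$ (a*dA+p, b*dA+q) * ?X $$ (q,p) = (\<Sum>a'<dB. \<Sum>p'<dA. \<Sum>b'<dB. \<Sum>q'<dA. ?t p q a' p' b' q')"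
      if "p < dA" "q < dA" for p q
    proof -
      let ?V = "kron (cconj_mat (UB g)) (UA g)"
      have "J $$ (a*dA+p, b*dA+q) = (?V * J * dagger ?V) $$ (a*dA+p, b*dA+q)" by (simp only: inv)
      also have "\<dots> = (\<Sum>a'<dB. \<Sum>p'<dA. \<Sum>b'<dB. \<Sum>q'<dA.
          ?V $$ (a*dA+p, a'*dA+p') * cnj (?V $$ (b*dA+q, b'*dA+q')) * J $$ (a'*dA+p', b'*dA+q'))"
        using i that by (simp add: conj_index[OF A.RX.V_carrier J] mult_add_less sum_lessThan_mult)
      also have "\<dots> = (\<Sum>a'<dB. \<Sum>p'<dA. \<Sum>b'<dB. \<Sum>q'<dA. (cnj (UB g $$ (a,a')) * UA g $$ (p,p'))
          * (UB g $$ (b,b') * cnj (UA g $$ (q,q'))) * J $$ (a'*dA+p', b'*dA+q'))"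
        using i that by (intro sum.cong refl) (simp add: kron_index[of _ dB _ dA] cconj_mat_index[of _ dB dB])
      finally show ?thesis by (simp only: sum_distrib_right)
    qed
    have "?E ?X $$ (b,a) = (\<Sum>p<dA. \<Sum>q<dA. \<Sum>a'<dB. \<Sum>p'<dA. \<Sum>b'<dB. \<Sum>q'<dA. ?t p q a' p' b' q')"
      unfolding choi_map_index[OF i] by (intro sum.cong refl) (simp only: ent lessThan_iff)
    also have "\<dots> = (\<Sum>a'<dB. \<Sum>p'<dA. \<Sum>p<dA. \<Sum>q<dA. \<Sum>b'<dB. \<Sum>q'<dA. ?t p q a' p' b' q')"
      by (rule sum_swap_pairs)
    also have "\<dots> = (\<Sum>a'<dB. \<Sum>p'<dA. \<Sum>b'<dB. \<Sum>q'<dA. \<Sum>p<dA. \<Sum>q<dA. ?t p q a' p' b' q')"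
      by (rule sum.cong[OF refl], rule sum.cong[OF refl], rule sum_swap_pairs)
    also have "\<dots> = (\<Sum>a'<dB. \<Sum>p'<dA. \<Sum>b'<dB. \<Sum>q'<dA.
        UB g $$ (b,b') * cnj (UB g $$ (a,a')) * (J $$ (a'*dA+p', b'*dA+q') * X $$ (q',p')))"
    proof (intro sum.cong refl)
      fix a' p' b' q' assume "p' \<in> {..<dA}" "q' \<in> {..<dA}"
      thus "(\<Sum>p<dA. \<Sum>q<dA. ?t p q a' p' b' q')
        = UB g $$ (b,b') * cnj (UB g $$ (a,a')) * (J $$ (a'*dA+p', b'*dA+q') * X $$ (q',p'))"
        by (simp only: undo[symmetric] lessThan_iff sum_distrib_left) (intro sum.cong refl, simp only: mult_ac)
    qed
    also have "\<dots> = (\<Sum>b'<dB. \<Sum>a'<dB. \<Sum>p'<dA. \<Sum>q'<dA.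
        UB g $$ (b,b') * cnj (UB g $$ (a,a')) * (J $$ (a'*dA+p', b'*dA+q') * X $$ (q',p')))"
      by (subst (2) sum.swap) (rule sum.swap)
    also have "\<dots> = (UB g * ?E X * dagger (UB g)) $$ (b,a)"
      by (simp add: conj_index[OF UB choi_map_carrier i] choi_map_index sum_distrib_left)
    finally show "?E ?X $$ (b,a) = (UB g * ?E X * dagger (UB g)) $$ (b,a)" .
  next
    have "UB g * ?E X * dagger (UB g) \<in> carrier_mat dB dB" by simp
    thus "dim_row (?E ?X) = dim_row (UB g * ?E X * dagger (UB g))" "dim_col (?E ?X) = dim_col (UB g * ?E X * dagger (UB g))"
      unfolding carrier_mat_def by (simp_all add: choi_map_def)
  qed
qed

section \<open>Compactness of invariant states and separation\<close>

lemma residual_convex_min: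
  fixes x y :: "'k \<Rightarrow> complex"
  assumes min: "\<And>t. 0 < t \<Longrightarrow> t \<le> 1 \<Longrightarrow>
      (\<Sum>k\<in>I. (cmod (x k))\<^sup>2) \<le> (\<Sum>k\<in>I. (cmod (of_real (1 - t) * x k + of_real t * y k))\<^sup>2)"
  shows "(\<Sum>k\<in>I. (cmod (x k))\<^sup>2) \<le> Re (\<Sum>k\<in>I. cnj (x k) * y k)"
proof -
  define P Q where "P = (\<Sum>k\<in>I. Re (cnj (x k) * (y k - x k)))" "Q = (\<Sum>k\<in>I. (cmod (y k - x k))\<^sup>2)"
  have Q0: "Q \<ge> 0" by (simp add: P_Q_def sum_nonneg)
  have norm_sq: "(cmod (of_real (1 - t) * a + of_real t * b))\<^sup>2
      = (cmod a)\<^sup>2 + 2 * t * Re (cnj a * (b - a)) + t\<^sup>2 * (cmod (b - a))\<^sup>2" for t a b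
    unfolding cmod_power2 by (simp add: power2_eq_square algebra_simps)
  have expand: "(\<Sum>k\<in>I. (cmod (of_real (1 - t) * x k + of_real t * y k))\<^sup>2)
      = (\<Sum>k\<in>I. (cmod (x k))\<^sup>2) + 2 * t * P + t\<^sup>2 * Q" for t
    unfolding norm_sq P_Q_def by (simp only: sum.distrib sum_distrib_left)
  have step: "0 \<le> 2 * P + t * Q" if "0 < t" "t \<le> 1" for t
  proof -
    have "0 \<le> 2 * t * P + t\<^sup>2 * Q" using min[OF that] unfolding expand by simp
    hence "0 \<le> t * (2 * P + t * Q)" by (simp add: power2_eq_square algebra_simps)
    thus ?thesis using that by (simp add: zero_le_mult_iff)
  qed
  have "P \<ge> 0"
  proof (rule ccontr)
    assume "\<not> P \<ge> 0"
    hence P: "P < 0" by simp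
    define t where "t = min 1 (- P / (Q + 1))"
    have t: "0 < t" "t \<le> 1" "t \<le> - P / (Q + 1)" using P Q0 by (auto simp: t_def divide_neg_pos)
    have "t * (Q + 1) \<le> - P" using t(3) Q0 by (simp add: field_simps)
    hence "t * Q \<le> - P" using t(1) by (simp add: algebra_simps)
    thus False using step[OF t(1,2)] P by simp
  qed
  moreover have "Re (cnj (x k) * (y k - x k)) = Re (cnj (x k) * y k) - (cmod (x k))\<^sup>2" for k
    unfolding cmod_power2 by (simp add: power2_eq_square algebra_simps)
  hence "P = Re (\<Sum>k\<in>I. cnj (x k) * y k) - (\<Sum>k\<in>I. (cmod (x k))\<^sup>2)"
    unfolding P_Q_def(1) by (simp add: sum_subtractf)
  ultimately show ?thesis by simp
qed

lemma compact_bounded_functions: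
  fixes K :: "('i \<Rightarrow> complex) set"
  assumes "closed K" and bound: "\<And>J p. J \<in> K \<Longrightarrow> cmod (J p) \<le> c"
  shows "compact K"
proof -
  have "compactin (product_topology (\<lambda>_::'i. euclidean) UNIV) (PiE UNIV (\<lambda>_. cball (0::complex) c))"
    unfolding compactin_PiE by simp
  hence "compact (PiE UNIV (\<lambda>_::'i. cball (0::complex) c))"
    by (simp add: euclidean_product_topology)
  from compact_Int_closed[OF this assms(1)] have "compact (PiE UNIV (\<lambda>_. cball 0 c) \<inter> K)" .
  moreover have "PiE UNIV (\<lambda>_. cball 0 c) \<inter> K = K" using bound by (auto simp: PiE_UNIV_domain)
  ultimately show ?thesis by simp
qed

text \<open>Separation of a compact convex set of matrices from the solutions of an affine system:
  the separating functional is the residual at the least squares point.\<close>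

lemma affine_system_alternative:
  fixes K :: "('i \<Rightarrow> complex) set" and r :: "'k \<Rightarrow> ('i \<Rightarrow> complex) \<Rightarrow> complex"
  assumes K: "compact K" "K \<noteq> {}"
    and convex: "\<And>J J' t. J \<in> K \<Longrightarrow> J' \<in> K \<Longrightarrow> 0 < t \<Longrightarrow> t \<le> 1 \<Longrightarrow> (\<lambda>p. of_real (1 - t) * J p + of_real t * J' p) \<in> K"
    and cont: "\<And>k. continuous_on UNIV (r k)"
    and affine: "\<And>k J J' t. k \<in> I \<Longrightarrow>
      r k (\<lambda>p. of_real (1 - t) * J p + of_real t * J' p) = of_real (1 - t) * r k J + of_real t * r k J'"
    and "finite I"
  obtains J where "J \<in> K" "\<forall>k\<in>I. r k J = 0"
    | J F where "J \<in> K" "0 < (F::real)" "\<And>J'. J' \<in> K \<Longrightarrow> F \<le> Re (\<Sum>k\<in>I. cnj (r k J) * r k J')"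
proof -
  define f where "f = (\<lambda>J. \<Sum>k\<in>I. (cmod (r k J))\<^sup>2)"
  have "continuous_on K f"
    unfolding f_def
    by (intro continuous_on_sum continuous_on_power continuous_on_norm continuous_on_subset[OF cont]) auto
  from continuous_attains_inf[OF K this]
  obtain J where J: "J \<in> K" "\<And>J'. J' \<in> K \<Longrightarrow> f J \<le> f J'" by auto
  show ?thesis
  proof (cases "f J = 0")
    case True
    hence "\<forall>k\<in>I. r k J = 0" using \<open>finite I\<close> by (simp add: f_def sum_nonneg_eq_0_iff)
    thus ?thesis using J that(1) by blast
  next
    case False
    have "f J \<ge> 0" by (simp add: f_def sum_nonneg)
    with False have "f J > 0" by simp
    moreover have "f J \<le> Re (\<Sum>k\<in>I. cnj (r k J) * r k J')" if "J' \<in> K" for J'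
      unfolding f_def
    proof (rule residual_convex_min)
      fix t :: real assume t: "0 < t" "t \<le> 1"
      have "f J \<le> f (\<lambda>p. of_real (1 - t) * J p + of_real t * J' p)"
        by (intro J convex that t)
      also have "\<dots> = (\<Sum>k\<in>I. (cmod (of_real (1 - t) * r k J + of_real t * r k J'))\<^sup>2)"
        unfolding f_def by (intro sum.cong refl) (simp only: affine)
      finally show "(\<Sum>k\<in>I. (cmod (r k J))\<^sup>2) \<le> (\<Sum>k\<in>I. (cmod (of_real (1 - t) * r k J + of_real t * r k J'))\<^sup>2)"
        by (simp only: f_def)
    qed
    ultimately show ?thesis using J(1) that(2) by blast
  qed
qed

lemma psd_fun_entry_le_trace:
  assumes "psd_fun n F" "i < n" "j < n"
  shows "cmod (F (i,j)) \<le> Re (\<Sum>k<n. F (k,k))"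
proof -
  let ?t = "Re (\<Sum>k<n. F (k,k))"
  have d: "0 \<le> Re (F (k,k))" if "k < n" for k
    using psd_fun_diag_nonneg[OF assms(1) that] by (simp add: less_eq_complex_def)
  have le: "Re (F (k,k)) \<le> ?t" if "k < n" for k
    unfolding Re_sum using that d by (intro member_le_sum) auto
  have "(cmod (F (i,j)))\<^sup>2 \<le> Re (F (i,i)) * Re (F (j,j))" by (rule psd_fun_entry_bound[OF assms])
  also have "\<dots> \<le> ?t * ?t"
    by (intro mult_mono le assms(2,3) d order_trans[OF d[OF assms(2)] le[OF assms(2)]])
  finally have "(cmod (F (i,j)))\<^sup>2 \<le> ?t\<^sup>2" by (simp only: power2_eq_square)
  thus ?thesis by (rule power2_le_imp_le) (rule order_trans[OF d[OF assms(2)] le[OF assms(2)]])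
qed

lemma mtrace_mult_kron:
  assumes J: "J \<in> carrier_mat (dB*dA) (dB*dA)" and S: "S \<in> carrier_mat dB dB" and X: "X \<in> carrier_mat dA dA"
  shows "mtrace (J * kron S X) = (\<Sum>b<dB. \<Sum>a<dB. S $$ (b,a) * choi_map dA dB (($$) J) X $$ (b,a))"
proof -
  have "mtrace (J * kron S X) = (\<Sum>a<dB. \<Sum>p<dA. \<Sum>b<dB. \<Sum>q<dA. J $$ (a*dA+p, b*dA+q) * kron S X $$ (b*dA+q, a*dA+p))"
    by (simp add: mtrace_mult[OF J kron_carrier[OF S X]] sum_lessThan_mult)
  also have "\<dots> = (\<Sum>a<dB. \<Sum>p<dA. \<Sum>b<dB. \<Sum>q<dA. J $$ (a*dA+p, b*dA+q) * (S $$ (b,a) * X $$ (q,p)))"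
    by (intro sum.cong refl) (simp add: kron_index[OF S X])
  also have "\<dots> = (\<Sum>a<dB. \<Sum>b<dB. \<Sum>p<dA. \<Sum>q<dA. J $$ (a*dA+p, b*dA+q) * (S $$ (b,a) * X $$ (q,p)))"
    by (intro sum.cong refl sum.swap)
  also have "\<dots> = (\<Sum>a<dB. \<Sum>b<dB. S $$ (b,a) * choi_map dA dB (($$) J) X $$ (b,a))"
    by (intro sum.cong refl) (simp add: choi_map_index sum_distrib_left mult_ac)
  finally show ?thesis by (subst sum.swap)
qed

lemma continuous_eval: "continuous_on S (\<lambda>J :: 'i \<Rightarrow> complex. J p)"
  by (rule continuous_on_subset[OF continuous_on_product_coordinates]) auto

lemma continuous_sesq: "continuous_on S (\<lambda>J. sesq n J x y)"
  unfolding sesq_def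
  by (intro continuous_on_sum continuous_on_mult continuous_on_const continuous_eval)

lemma closed_psd_fun: "closed {J. psd_fun n J}"
proof -
  have "closed {J. 0 \<le> sesq n J x x}" for x
    unfolding less_eq_complex_def zero_complex.sel
    by (intro closed_Collect_conj closed_Collect_le closed_Collect_eq continuous_on_Re continuous_on_Im
        continuous_sesq continuous_on_const)
  thus ?thesis unfolding psd_fun_def by (rule closed_Collect_all)
qed

text \<open>Matrices are represented by functions vanishing outside the index range, so that the product
  topology on functions is available.\<close>

definition invariant_states :: "nat \<Rightarrow> ('g \<Rightarrow> complex mat) \<Rightarrow> complex \<Rightarrow> (nat \<times> nat \<Rightarrow> complex) set" where
  "invariant_states n V t = {J. psd_fun n J \<and> (\<forall>i j. \<not> (i < n \<and> j < n) \<longrightarrow> J (i,j) = 0) \<and>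
     (\<forall>g i j. i < n \<and> j < n \<longrightarrow> (\<Sum>k<n. \<Sum>l<n. V g $$ (i,k) * cnj (V g $$ (j,l)) * J (k,l)) = J (i,j)) \<and>
     (\<Sum>i<n. J (i,i)) = t}"

lemma closed_invariant_states: "closed (invariant_states n V c)"
proof -
  define S1 where "S1 = (\<lambda>i j. {J :: nat \<times> nat \<Rightarrow> complex. \<not> (i < n \<and> j < n) \<longrightarrow> J (i,j) = 0})"
  define S2 where "S2 = (\<lambda>g i j. {J :: nat \<times> nat \<Rightarrow> complex. i < n \<and> j < n \<longrightarrow>
      (\<Sum>k<n. \<Sum>l<n. V g $$ (i,k) * cnj (V g $$ (j,l)) * J (k,l)) = J (i,j)})"
  define S3 where "S3 = {J :: nat \<times> nat \<Rightarrow> complex. (\<Sum>i<n. J (i,i)) = c}"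
  have c1: "closed (S1 i j)" for i j
    unfolding S1_def
    by (cases "i < n \<and> j < n") (simp_all add: closed_Collect_eq[OF continuous_eval continuous_on_const])
  have c2: "closed (S2 g i j)" for g i j
  proof -
    have "continuous_on UNIV (\<lambda>J. \<Sum>k<n. \<Sum>l<n. V g $$ (i,k) * cnj (V g $$ (j,l)) * J (k,l))"
      by (intro continuous_on_sum continuous_on_mult_left continuous_eval)
    note closed = closed_Collect_eq[OF this continuous_eval]
    show ?thesis
    proof (cases "i < n \<and> j < n")
      case True
      thus ?thesis unfolding S2_def using closed by simp
    next
      case False
      hence "S2 g i j = UNIV" by (auto simp: S2_def)
      thus ?thesis by simp
    qed
  qed
  have c3: "closed S3"
  proof -
    have "continuous_on UNIV (\<lambda>J :: nat \<times> nat \<Rightarrow> complex. \<Sum>i<n. J (i,i))"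
      by (intro continuous_on_sum continuous_eval)
    from closed_Collect_eq[OF this continuous_on_const] show ?thesis unfolding S3_def .
  qed
  have "invariant_states n V c = {J. psd_fun n J} \<inter> (\<Inter>i. \<Inter>j. S1 i j) \<inter> (\<Inter>g. \<Inter>i. \<Inter>j. S2 g i j) \<inter> S3"
    by (simp add: invariant_states_def S1_def S2_def S3_def Collect_conj_eq Collect_all_eq Int_assoc)
  also have "closed \<dots>" by (intro closed_Int closed_INT ballI closed_psd_fun c1 c2 c3)
  finally show ?thesis .
qed

lemma compact_invariant_states: "compact (invariant_states n V c)"
proof (rule compact_bounded_functions[OF closed_invariant_states])
  fix J and p :: "nat \<times> nat" assume J: "J \<in> invariant_states n V c"
  obtain i j where p: "p = (i,j)" by (cases p)
  show "cmod (J p) \<le> cmod c"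
  proof (cases "i < n \<and> j < n")
    case True
    hence "cmod (J p) \<le> Re c"
      using J psd_fun_entry_le_trace[of n J i j] by (auto simp: p invariant_states_def)
    thus ?thesis by (rule order_trans[OF _ complex_Re_le_cmod])
  next
    case False
    thus ?thesis using J by (auto simp: p invariant_states_def)
  qed
qed

lemma convex_invariant_states:
  assumes "J \<in> invariant_states n V c" "J' \<in> invariant_states n V c" "0 < t" "t \<le> (1::real)"
  shows "(\<lambda>p. of_real (1 - t) * J p + of_real t * J' p) \<in> invariant_states n V c"
  unfolding invariant_states_def
proof (intro CollectI conjI allI impI)
  let ?J = "\<lambda>p. of_real (1 - t) * J p + of_real t * J' p"
  show "psd_fun n ?J"
    unfolding psd_fun_def
  proof
    fix x
    have "0 \<le> sesq n J x x" "0 \<le> sesq n J' x x"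
      using assms by (auto simp: invariant_states_def psd_fun_def)
    thus "0 \<le> sesq n ?J x x"
      unfolding sesq_add sesq_smult using assms(3,4) by (auto simp: less_eq_complex_def)
  qed
  fix g i j
  show "?J (i,j) = 0" if "\<not> (i < n \<and> j < n)" using assms that by (auto simp: invariant_states_def)
  show "(\<Sum>k<n. \<Sum>l<n. V g $$ (i,k) * cnj (V g $$ (j,l)) * ?J (k,l)) = ?J (i,j)" if ij: "i < n \<and> j < n"
  proof -
    let ?c = "\<lambda>k l. V g $$ (i,k) * cnj (V g $$ (j,l))"
    have "(\<Sum>k<n. \<Sum>l<n. ?c k l * ?J (k,l))
      = of_real (1 - t) * (\<Sum>k<n. \<Sum>l<n. ?c k l * J (k,l)) + of_real t * (\<Sum>k<n. \<Sum>l<n. ?c k l * J' (k,l))"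
      unfolding sum_distrib_left sum.distrib[symmetric] by (intro sum.cong refl) (simp only: distrib_left mult_ac)
    also have "\<dots> = ?J (i,j)" using assms(1,2) ij unfolding invariant_states_def by simp
    finally show ?thesis .
  qed
next
  have "(\<Sum>i<n. of_real (1 - t) * J (i,i) + of_real t * J' (i,i))
    = of_real (1 - t) * (\<Sum>i<n. J (i,i)) + of_real t * (\<Sum>i<n. J' (i,i))"
    by (simp only: sum.distrib sum_distrib_left)
  also have "\<dots> = c" using assms(1,2) by (simp add: invariant_states_def algebra_simps)
  finally show "(\<Sum>i<n. of_real (1 - t) * J (i,i) + of_real t * J' (i,i)) = c" .
qed

context rep
begin

lemma invariant_statesI:
  assumes M: "psd n M" and inv: "\<And>g. conj g M = M" and tr: "mtrace M = c"
  shows "(\<lambda>(i,j). if i < n \<and> j < n then M $$ (i,j) else 0) \<in> invariant_states n V c"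
  unfolding invariant_states_def
proof (intro CollectI conjI allI impI)
  have Mc: "M \<in> carrier_mat n n" and psd: "psd_fun n (($$) M)" using M by (auto simp: psd_iff)
  let ?J = "\<lambda>(i,j). if i < n \<and> j < n then M $$ (i,j) else 0"
  have "psd_fun n ?J = psd_fun n (($$) M)" by (rule psd_fun_cong) simp
  thus "psd_fun n ?J" using psd by simp
  show "(\<Sum>i<n. ?J (i,i)) = c" using tr Mc by (simp add: mtrace_carrier)
  fix g i j
  show "?J (i,j) = 0" if "\<not> (i < n \<and> j < n)" using that by auto
  assume ij: "i < n \<and> j < n"
  have "(\<Sum>k<n. \<Sum>l<n. V g $$ (i,k) * cnj (V g $$ (j,l)) * ?J (k,l))
    = (\<Sum>k<n. \<Sum>l<n. V g $$ (i,k) * cnj (V g $$ (j,l)) * M $$ (k,l))"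
    by (intro sum.cong refl) simp
  also have "\<dots> = conj g M $$ (i,j)"
    using ij by (intro conj_index[symmetric] V_carrier Mc) auto
  also have "\<dots> = ?J (i,j)" using ij by (simp only: inv) simp
  finally show "(\<Sum>k<n. \<Sum>l<n. V g $$ (i,k) * cnj (V g $$ (j,l)) * ?J (k,l)) = ?J (i,j)" .
qed

lemma invariant_statesD:
  assumes J: "J \<in> invariant_states n V c"
  shows "psd n (mat n n J)" "conj g (mat n n J) = mat n n J" "mtrace (mat n n J) = c"
proof -
  have "psd_fun n (($$) (mat n n J)) = psd_fun n J" by (rule psd_fun_cong) simp
  thus "psd n (mat n n J)" using J by (simp add: psd_iff invariant_states_def)
  show "conj g (mat n n J) = mat n n J"
  proof (rule eq_matI)
    fix i j assume "i < dim_row (mat n n J)" "j < dim_col (mat n n J)"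
    hence ij: "i < n" "j < n" by auto
    have "conj g (mat n n J) $$ (i,j) = (\<Sum>k<n. \<Sum>l<n. V g $$ (i,k) * cnj (V g $$ (j,l)) * mat n n J $$ (k,l))"
      by (intro conj_index V_carrier ij) auto
    also have "\<dots> = (\<Sum>k<n. \<Sum>l<n. V g $$ (i,k) * cnj (V g $$ (j,l)) * J (k,l))"
      by (intro sum.cong refl) simp
    also have "\<dots> = mat n n J $$ (i,j)" using J ij by (simp add: invariant_states_def)
    finally show "conj g (mat n n J) $$ (i,j) = mat n n J $$ (i,j)" .
  next
    have "conj g (mat n n J) \<in> carrier_mat n n" by (rule conj_carrier) simp
    thus "dim_row (conj g (mat n n J)) = dim_row (mat n n J)" "dim_col (conj g (mat n n J)) = dim_col (mat n n J)"
      unfolding carrier_mat_def by simp_all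
  qed
  show "mtrace (mat n n J) = c" using J by (simp add: mtrace_def invariant_states_def)
qed

lemma invariant_states_nonempty:
  assumes "n > 0" "0 \<le> (c::real)"
  shows "invariant_states n V (of_real c) \<noteq> {}"
proof -
  let ?M = "of_real (c / n) \<cdot>\<^sub>m 1\<^sub>m n"
  have "psd n ?M"
    using assms(2) by (intro psd_smult) (auto simp: psd_iff psd_fun_def sesq_one less_eq_complex_def intro: sum_nonneg)
  moreover have "conj g ?M = ?M" for g
  proof -
    have "V g * ?M = of_real (c / n) \<cdot>\<^sub>m V g"
      using mult_smult_distrib[OF V_carrier one_carrier_mat, of g] right_mult_one_mat[OF V_carrier] by simp
    hence "conj g ?M = of_real (c / n) \<cdot>\<^sub>m (V g * dagger (V g))"
      using mult_smult_assoc_mat[OF V_carrier dagger_carrier[OF V_carrier], of _ g g] by simp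
    also have "V g * dagger (V g) = 1\<^sub>m n"
      using unitary_rep by (simp add: unitary_rep_def unitary_def)
    finally show ?thesis .
  qed
  moreover have "mtrace ?M = of_real c" using assms by (simp add: mtrace_smult[of _ n] mtrace_one)
  ultimately show ?thesis using invariant_statesI[of ?M] by blast
qed

end

section \<open>Separating witnesses\<close>

lemma sesq_mtrace:
  assumes "A \<in> carrier_mat n n"
  shows "sesq n (($$) A) v v = mtrace (A * mat n n (\<lambda>(i,j). v i * cnj (v j)))"
  by (simp add: mtrace_mult[OF assms mat_carrier] sesq_def mult_ac)

lemma psd_rank_one: "psd n (mat n n (\<lambda>(i,j). v i * cnj (v j)))"
proof -
  have "psd_fun n (($$) (mat n n (\<lambda>(i,j). v i * cnj (v j)))) \<longleftrightarrow> psd_fun n (\<lambda>(i,j). v i * cnj (v j))"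
    by (rule psd_fun_cong) simp
  thus ?thesis by (simp add: psd_iff psd_fun_rank_one)
qed

lemma mtrace_hermitian_real:
  assumes A: "A \<in> carrier_mat n n" "\<And>i j. i < n \<Longrightarrow> j < n \<Longrightarrow> A $$ (j,i) = cnj (A $$ (i,j))"
    and B: "psd n B"
  shows "Im (mtrace (A * B)) = 0"
proof -
  have Bc: "B \<in> carrier_mat n n" "psd_fun n (($$) B)" using B by (auto simp: psd_iff)
  have "cnj (mtrace (A * B)) = (\<Sum>i<n. \<Sum>j<n. A $$ (j,i) * B $$ (i,j))"
    unfolding mtrace_mult[OF A(1) Bc(1)] cnj_sum
  proof (intro sum.cong refl)
    fix i j assume "i \<in> {..<n}" "j \<in> {..<n}"
    hence ij: "i < n" "j < n" by auto
    show "cnj (A $$ (i,j) * B $$ (j,i)) = A $$ (j,i) * B $$ (i,j)"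
      using A(2)[OF ij] psd_fun_hermitian[OF Bc(2) ij(2,1)] by simp
  qed
  also have "\<dots> = mtrace (A * B)"
    unfolding mtrace_mult[OF A(1) Bc(1)] by (rule sum.swap)
  finally show ?thesis by (simp add: complex_eq_iff)
qed

text \<open>To test positivity of the twirl of a matrix it suffices to pair the matrix itself with invariant states,
  since the twirl is self-adjoint for the trace pairing.\<close>

lemma (in rep) psd_twI:
  assumes M: "M \<in> carrier_mat n n"
    and herm: "\<And>i j. i < n \<Longrightarrow> j < n \<Longrightarrow> M $$ (j,i) = cnj (M $$ (i,j))" and "c > 0"
    and pos: "\<And>J. J \<in> invariant_states n V (of_real c) \<Longrightarrow> 0 \<le> Re (mtrace (mat n n J * M))"
  shows "psd n (tw M)"
proof -
  have "0 \<le> sesq n (($$) (tw M)) v v" for v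
  proof -
    define P where "P = mat n n (\<lambda>(i,j). v i * cnj (v j))"
    have P: "psd n P" unfolding P_def by (rule psd_rank_one)
    have Pc: "P \<in> carrier_mat n n" by (simp add: P_def)
    have eq: "sesq n (($$) (tw M)) v v = mtrace (M * tw P)"
      unfolding sesq_mtrace[OF tw_carrier] P_def[symmetric] by (rule mtrace_tw_adjoint[OF M Pc])
    have im: "Im (mtrace (M * tw P)) = 0" by (rule mtrace_hermitian_real[OF M herm psd_tw[OF P]])
    define s where "s = (\<Sum>i<n. (cmod (v i))\<^sup>2)"
    have trP: "mtrace P = of_real s"
      unfolding s_def of_real_sum complex_norm_square by (simp add: P_def mtrace_carrier[of _ n])
    have s0: "0 \<le> s" by (simp add: s_def sum_nonneg)
    have re: "0 \<le> Re (mtrace (M * tw P))"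
    proof (cases "s = 0")
      case True
      hence "\<forall>i<n. v i = 0" by (simp add: s_def sum_nonneg_eq_0_iff)
      hence "sesq n (($$) (tw M)) v v = 0" by (simp add: sesq_def)
      thus ?thesis by (simp add: eq)
    next
      case False
      hence s: "s > 0" using s0 by simp
      let ?Q = "of_real (c / s) \<cdot>\<^sub>m tw P"
      define J where "J = (\<lambda>(i,j). if i < n \<and> j < n then ?Q $$ (i,j) else 0)"
      have tQ: "?Q = tw (of_real (c / s) \<cdot>\<^sub>m P)" using Pc by (simp add: tw_smult)
      have "psd n ?Q" using s \<open>c > 0\<close> by (intro psd_smult psd_tw P) auto
      moreover have "conj g ?Q = ?Q" for g unfolding tQ by (intro conj_tw smult_carrier_mat Pc)
      moreover have "mtrace ?Q = of_real c"
        using s by (simp add: mtrace_smult[of _ n] mtrace_tw Pc trP)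
      ultimately have "J \<in> invariant_states n V (of_real c)"
        unfolding J_def by (rule invariant_statesI)
      from pos[OF this] have "0 \<le> Re (mtrace (mat n n J * M))" .
      also have "mat n n J = ?Q"
        unfolding J_def by (intro eq_matI) (auto simp: carrier_matD[OF tw_carrier[of P]])
      also have "mtrace (?Q * M) = of_real (c / s) * mtrace (M * tw P)"
        using M mtrace_smult[of "tw P * M" n] mtrace_mult_commute[OF tw_carrier M, of P]
        by (simp add: mult_smult_assoc_mat[OF tw_carrier M])
      finally have "0 \<le> c / s * Re (mtrace (M * tw P))" by simp
      thus ?thesis using s \<open>c > 0\<close> by (simp add: zero_le_mult_iff zero_le_divide_iff)
    qed
    show ?thesis unfolding eq using im re by (simp add: less_eq_complex_def)
  qed
  thus ?thesis by (simp add: psd_iff psd_fun_def)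
qed

lemma psd_kron_one_cancel:
  assumes psd: "psd (d*m) (kron (1\<^sub>m d) Y)" and Y: "Y \<in> carrier_mat m m" and "d > 0"
  shows "psd m Y"
proof -
  have "0 \<le> sesq m (($$) Y) v v" for v
  proof -
    define w where "w = (\<lambda>i. if i div m = 0 then v (i mod m) else 0)"
    have w: "w (a*m+p) = (if a = 0 then v p else 0)" if "p < m" for a p
      using that by (simp add: w_def)
    have "sesq (d*m) (($$) (kron (1\<^sub>m d) Y)) w w
      = (\<Sum>a<d. \<Sum>p<m. \<Sum>b<d. \<Sum>q<m. if b = 0 then (if a = 0 then cnj (v p) * Y $$ (p,q) * v q else 0) else 0)"
      unfolding sesq_mult
      by (intro sum.cong refl) (simp add: w kron_index[OF one_carrier_mat Y])
    also have "\<dots> = (\<Sum>a<d. \<Sum>p<m. \<Sum>b<d. if b = 0 then (\<Sum>q<m. if a = 0 then cnj (v p) * Y $$ (p,q) * v q else 0) else 0)"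
      by (intro sum.cong refl) simp
    also have "\<dots> = (\<Sum>a<d. if a = 0 then sesq m (($$) Y) v v else 0)"
      using \<open>d > 0\<close> by (intro sum.cong refl) (simp add: sesq_def)
    also have "\<dots> = sesq m (($$) Y) v v" using \<open>d > 0\<close> by simp
    finally show ?thesis using psd unfolding psd_iff psd_fun_def by metis
  qed
  thus ?thesis using Y by (simp add: psd_iff psd_fun_def)
qed

context two_reps
begin

lemma covariant_channel_or_witness:
  assumes \<rho>: "density dA \<rho>" and \<sigma>: "density dB \<sigma>" and pos: "dA > 0" "dB > 0"
  obtains E where "channel dA dB E" "covariant dA UA UB E" "E \<rho> = \<sigma>"
    | Y H where "Y \<in> carrier_mat dA dA" "H \<in> carrier_mat dB dB"
        "\<And>i j. i < dA \<Longrightarrow> j < dA \<Longrightarrow> Y $$ (j,i) = cnj (Y $$ (i,j))"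
        "\<And>i j. i < dB \<Longrightarrow> j < dB \<Longrightarrow> H $$ (j,i) = cnj (H $$ (i,j))"
        "Re (mtrace Y) < Re (\<Sum>b<dB. \<Sum>a<dB. H $$ (b,a) * \<sigma> $$ (b,a))"
        "psd (dB*dA) (A.RX.tw (kron (1\<^sub>m dB) Y - kron H \<rho>))"
proof -
  let ?K = "invariant_states (dB*dA) (\<lambda>g. kron (cconj_mat (UB g)) (UA g)) (of_real (real dA))"
  let ?J = "\<lambda>J. mat (dB*dA) (dB*dA) J"
  have \<rho>c: "\<rho> \<in> carrier_mat dA dA" "psd_fun dA (($$) \<rho>)" and \<sigma>c: "\<sigma> \<in> carrier_mat dB dB" "psd_fun dB (($$) \<sigma>)"
    using \<rho> \<sigma> by (auto simp: density_def psd_iff)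
  define I :: "(nat \<times> nat + nat \<times> nat) set" where "I = ({..<dA} \<times> {..<dA}) <+> ({..<dB} \<times> {..<dB})"
  define T where "T = (\<lambda>J :: nat \<times> nat \<Rightarrow> complex. \<lambda>(p,q). \<Sum>a<dB. J (a*dA+p, a*dA+q))"
  define R where "R = (\<lambda>J :: nat \<times> nat \<Rightarrow> complex. \<lambda>(b,a). \<Sum>p<dA. \<Sum>q<dA. J (a*dA+p, b*dA+q) * \<rho> $$ (q,p))"
  define r where "r = (\<lambda>k J. case k of Inl pq \<Rightarrow> T J pq - (if fst pq = snd pq then 1 else 0) | Inr ba \<Rightarrow> R J ba - \<sigma> $$ ba)"
  have cont: "continuous_on UNIV (r k)" for k
  proof (cases k)
    case (Inl pq)
    have "continuous_on UNIV (\<lambda>J. T J pq)"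
      unfolding T_def case_prod_unfold by (intro continuous_on_sum continuous_eval)
    hence "continuous_on UNIV (\<lambda>J. T J pq - (if fst pq = snd pq then 1 else 0))"
      by (rule continuous_on_diff[OF _ continuous_on_const])
    thus ?thesis by (simp add: r_def Inl)
  next
    case (Inr ba)
    have "continuous_on UNIV (\<lambda>J. R J ba)"
      unfolding R_def case_prod_unfold by (intro continuous_on_sum continuous_on_mult_right continuous_eval)
    hence "continuous_on UNIV (\<lambda>J. R J ba - \<sigma> $$ ba)"
      by (rule continuous_on_diff[OF _ continuous_on_const])
    thus ?thesis by (simp add: r_def Inr)
  qed
  have T_lin: "T (\<lambda>p. x * J p + y * J' p) pq = x * T J pq + y * T J' pq" for x y J J' pq
    by (simp add: T_def case_prod_unfold sum.distrib sum_distrib_left)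
  have R_lin: "R (\<lambda>p. x * J p + y * J' p) ba = x * R J ba + y * R J' ba" for x y J J' ba
    by (simp add: R_def case_prod_unfold sum.distrib sum_distrib_left distrib_right mult.assoc)
  have affine: "r k (\<lambda>p. of_real (1 - t) * J p + of_real t * J' p) = of_real (1 - t) * r k J + of_real t * r k J'"
    for k J J' and t :: real
    by (cases k) (simp_all only: r_def sum.case T_lin R_lin, simp_all add: algebra_simps)
  have fin: "finite I" by (simp add: I_def)
  have ne: "?K \<noteq> {}" using pos by (intro A.RX.invariant_states_nonempty) auto
  show ?thesis
  proof (rule affine_system_alternative[OF compact_invariant_states ne convex_invariant_states cont affine fin])
    fix J assume J: "J \<in> ?K" and zero: "\<forall>k\<in>I. r k J = 0"
    note JD = A.RX.invariant_statesD[OF J]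
    let ?E = "choi_map dA dB (($$) (?J J))"
    have "(\<Sum>a<dB. ?J J $$ (a*dA+p, a*dA+q)) = (if p = q then 1 else 0)" if "p < dA" "q < dA" for p q
    proof -
      have "Inl (p,q) \<in> I" using that by (auto simp: I_def)
      hence "r (Inl (p,q)) J = 0" using zero by blast
      thus ?thesis using that by (simp add: r_def T_def mult_add_less)
    qed
    with JD(1) have "channel dA dB ?E" by (intro channel_choi_map) (auto simp: psd_iff)
    moreover have "covariant dA UA UB ?E" by (intro covariant_choi_map mat_carrier JD(2))
    moreover have "?E \<rho> = \<sigma>"
    proof (rule eq_matI)
      fix b a assume "b < dim_row \<sigma>" "a < dim_col \<sigma>"
      hence ba: "b < dB" "a < dB" using \<sigma>c by auto
      hence "Inr (b,a) \<in> I" by (auto simp: I_def)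
      hence "r (Inr (b,a)) J = 0" using zero by blast
      thus "?E \<rho> $$ (b,a) = \<sigma> $$ (b,a)" using ba by (simp add: r_def R_def choi_map_index mult_add_less)
    qed (use \<sigma>c in \<open>auto simp: choi_map_def\<close>)
    ultimately show thesis by (rule that(1))
  next
    fix J0 F assume J0: "J0 \<in> ?K" and F: "0 < (F::real)"
      and sep: "\<And>J. J \<in> ?K \<Longrightarrow> F \<le> Re (\<Sum>k\<in>I. cnj (r k J0) * r k J)"
    have J0psd: "psd_fun (dB*dA) J0" using J0 by (simp add: invariant_states_def)
    have T_herm: "T J0 (q,p) = cnj (T J0 (p,q))" if "p < dA" "q < dA" for p q
      unfolding T_def case_prod_conv cnj_sum using that
      by (intro sum.cong refl psd_fun_hermitian[OF J0psd]) (auto simp: mult_add_less)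
    have R_herm: "R J0 (a,b) = cnj (R J0 (b,a))" if "a < dB" "b < dB" for a b
    proof -
      have "cnj (R J0 (b,a)) = (\<Sum>p<dA. \<Sum>q<dA. J0 (b*dA+q, a*dA+p) * \<rho> $$ (p,q))"
        unfolding R_def case_prod_conv cnj_sum
      proof (intro sum.cong refl)
        fix p q assume "p \<in> {..<dA}" "q \<in> {..<dA}"
        hence pq: "p < dA" "q < dA" by auto
        show "cnj (J0 (a*dA+p, b*dA+q) * \<rho> $$ (q,p)) = J0 (b*dA+q, a*dA+p) * \<rho> $$ (p,q)"
          using psd_fun_hermitian[OF J0psd mult_add_less[OF that(1) pq(1)] mult_add_less[OF that(2) pq(2)]]
            psd_fun_hermitian[OF \<rho>c(2) pq(2,1)] by simp
      qed
      also have "\<dots> = R J0 (a,b)" unfolding R_def case_prod_conv by (rule sum.swap)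
      finally show ?thesis by simp
    qed
    define Y0 where "Y0 = mat dA dA (\<lambda>(q,p). cnj (r (Inl (p,q)) J0))"
    define H where "H = mat dB dB (\<lambda>(b,a). - cnj (r (Inr (b,a)) J0))"
    define h where "h = Re (\<Sum>b<dB. \<Sum>a<dB. H $$ (b,a) * \<sigma> $$ (b,a))"
    define \<beta> where "\<beta> = F + Re (mtrace Y0) - h"
    define Y where "Y = Y0 - of_real (\<beta> / dA) \<cdot>\<^sub>m 1\<^sub>m dA"
    have Y0c: "Y0 \<in> carrier_mat dA dA" and Hc: "H \<in> carrier_mat dB dB" by (simp_all add: Y0_def H_def)
    hence Yc: "Y \<in> carrier_mat dA dA" by (simp add: Y_def minus_carrier_mat)
    have Y_herm: "Y $$ (j,i) = cnj (Y $$ (i,j))" if "i < dA" "j < dA" for i j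
      using that T_herm[OF that] by (simp add: Y_def Y0_def r_def)
    have H_herm: "H $$ (j,i) = cnj (H $$ (i,j))" if "i < dB" "j < dB" for i j
      using that R_herm[OF that] psd_fun_hermitian[OF \<sigma>c(2) that] by (simp add: H_def r_def)
    have trY: "Re (mtrace Y) = h - F"
      using Y0c pos by (simp add: Y_def \<beta>_def mtrace_minus[of _ dA] mtrace_smult[of _ dA] mtrace_one)
    let ?M = "kron (1\<^sub>m dB) Y - kron H \<rho>"
    have Mc: "?M \<in> carrier_mat (dB*dA) (dB*dA)" using Yc Hc \<rho>c by (intro minus_carrier_mat kron_carrier)
    have M_herm: "?M $$ (j,i) = cnj (?M $$ (i,j))" if i: "i < dB*dA" and j: "j < dB*dA" for i j
    proof -
      note di = div_mod_less[OF i] and dj = div_mod_less[OF j]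
      have ent: "?M $$ (a*dA+p, b*dA+q) = (1\<^sub>m dB) $$ (a,b) * Y $$ (p,q) - H $$ (a,b) * \<rho> $$ (p,q)"
        if "a < dB" "p < dA" "b < dB" "q < dA" for a p b q
        using that Yc Hc \<rho>c carrier_matD[OF kron_carrier[OF Hc \<rho>c(1)]]
        by (simp add: mult_add_less kron_index[of _ dB _ dA])
      have "?M $$ (j,i) = (1\<^sub>m dB) $$ (j div dA, i div dA) * Y $$ (j mod dA, i mod dA)
          - H $$ (j div dA, i div dA) * \<rho> $$ (j mod dA, i mod dA)"
        using ent[OF dj(1,2) di(1,2)] by (simp only: di(3) dj(3))
      also have "\<dots> = cnj ((1\<^sub>m dB) $$ (i div dA, j div dA) * Y $$ (i mod dA, j mod dA)
          - H $$ (i div dA, j div dA) * \<rho> $$ (i mod dA, j mod dA))"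
        using di dj Y_herm[OF di(2) dj(2)] H_herm[OF di(1) dj(1)] psd_fun_hermitian[OF \<rho>c(2) di(2) dj(2)]
        by auto
      also have "\<dots> = cnj (?M $$ (i,j))"
        using ent[OF di(1,2) dj(1,2)] by (simp only: di(3) dj(3))
      finally show ?thesis .
    qed
    have "0 \<le> Re (mtrace (?J J * ?M))" if J: "J \<in> ?K" for J
    proof -
      have Jc: "?J J \<in> carrier_mat (dB*dA) (dB*dA)" by simp
      have choiY: "mtrace (?J J * kron (1\<^sub>m dB) Z) = (\<Sum>p<dA. \<Sum>q<dA. Z $$ (q,p) * T J (p,q))"
        if Z: "Z \<in> carrier_mat dA dA" for Z
      proof -
        have "mtrace (?J J * kron (1\<^sub>m dB) Z) = (\<Sum>b<dB. \<Sum>a<dB. if a = b then choi_map dA dB (($$) (?J J)) Z $$ (b,a) else 0)"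
          unfolding mtrace_mult_kron[OF Jc one_carrier_mat Z] by (intro sum.cong refl) auto
        also have "\<dots> = (\<Sum>a<dB. \<Sum>p<dA. \<Sum>q<dA. J (a*dA+p, a*dA+q) * Z $$ (q,p))"
          by (simp add: choi_map_index mult_add_less)
        also have "\<dots> = (\<Sum>p<dA. \<Sum>a<dB. \<Sum>q<dA. J (a*dA+p, a*dA+q) * Z $$ (q,p))"
          by (rule sum.swap)
        also have "\<dots> = (\<Sum>p<dA. \<Sum>q<dA. \<Sum>a<dB. J (a*dA+p, a*dA+q) * Z $$ (q,p))"
          by (intro sum.cong refl sum.swap)
        finally show ?thesis by (simp add: T_def sum_distrib_left mult.commute)
      qed
      have choiH: "mtrace (?J J * kron H \<rho>) = (\<Sum>b<dB. \<Sum>a<dB. H $$ (b,a) * R J (b,a))"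
        unfolding mtrace_mult_kron[OF Jc Hc \<rho>c(1)]
        by (intro sum.cong refl) (simp add: choi_map_index R_def mult_add_less)
      have "mtrace (?J J * kron (1\<^sub>m dB) (1\<^sub>m dA)) = of_nat dA"
        using A.RX.invariant_statesD(3)[OF J] by (simp add: kron_one right_mult_one_mat[OF Jc])
      hence "(\<Sum>p<dA. \<Sum>q<dA. (1\<^sub>m dA) $$ (q,p) * T J (p,q)) = of_nat dA"
        by (simp only: choiY one_carrier_mat)
      hence "(\<Sum>p<dA. \<Sum>q<dA. of_real (\<beta> / dA) * ((1\<^sub>m dA) $$ (q,p) * T J (p,q))) = of_real (\<beta> / dA) * of_nat dA"
        by (simp only: sum_distrib_left[symmetric])
      also have "\<dots> = of_real \<beta>" using pos by simp
      finally have one: "(\<Sum>p<dA. \<Sum>q<dA. of_real (\<beta> / dA) * ((1\<^sub>m dA) $$ (q,p) * T J (p,q))) = of_real \<beta>" .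
      have "(\<Sum>p<dA. \<Sum>q<dA. Y $$ (q,p) * T J (p,q))
        = (\<Sum>p<dA. \<Sum>q<dA. Y0 $$ (q,p) * T J (p,q)) - of_real \<beta>"
        unfolding one[symmetric] sum_subtractf[symmetric]
        using Y0c by (intro sum.cong refl) (simp add: Y_def algebra_simps)
      moreover have "mtrace (?J J * ?M) = mtrace (?J J * kron (1\<^sub>m dB) Y) - mtrace (?J J * kron H \<rho>)"
        by (simp only: mult_minus_distrib_mat[OF Jc kron_carrier[OF one_carrier_mat Yc] kron_carrier[OF Hc \<rho>c(1)]]
            mtrace_minus[OF mult_carrier_square[OF Jc kron_carrier[OF one_carrier_mat Yc]]
              mult_carrier_square[OF Jc kron_carrier[OF Hc \<rho>c(1)]]])
      ultimately have split: "mtrace (?J J * ?M) = (\<Sum>p<dA. \<Sum>q<dA. Y0 $$ (q,p) * T J (p,q)) - of_real \<beta>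
          - (\<Sum>b<dB. \<Sum>a<dB. H $$ (b,a) * R J (b,a))"
        by (simp only: choiY[OF Yc] choiH)
      have "(\<Sum>k\<in>I. cnj (r k J0) * r k J)
        = (\<Sum>p<dA. \<Sum>q<dA. cnj (r (Inl (p,q)) J0) * r (Inl (p,q)) J)
          + (\<Sum>b<dB. \<Sum>a<dB. cnj (r (Inr (b,a)) J0) * r (Inr (b,a)) J)"
        unfolding I_def by (simp add: sum.Plus sum.cartesian_product case_prod_unfold)
      also have "(\<Sum>p<dA. \<Sum>q<dA. cnj (r (Inl (p,q)) J0) * r (Inl (p,q)) J)
        = (\<Sum>p<dA. \<Sum>q<dA. Y0 $$ (q,p) * T J (p,q) - (if q = p then Y0 $$ (q,p) else 0))"
        by (intro sum.cong refl) (auto simp: Y0_def r_def algebra_simps)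
      also have "\<dots> = (\<Sum>p<dA. \<Sum>q<dA. Y0 $$ (q,p) * T J (p,q)) - mtrace Y0"
        using Y0c by (simp add: sum_subtractf mtrace_carrier)
      also have "(\<Sum>b<dB. \<Sum>a<dB. cnj (r (Inr (b,a)) J0) * r (Inr (b,a)) J)
        = (\<Sum>b<dB. \<Sum>a<dB. H $$ (b,a) * \<sigma> $$ (b,a) - H $$ (b,a) * R J (b,a))"
        by (intro sum.cong refl) (simp add: H_def r_def algebra_simps)
      also have "\<dots> = (\<Sum>b<dB. \<Sum>a<dB. H $$ (b,a) * \<sigma> $$ (b,a)) - (\<Sum>b<dB. \<Sum>a<dB. H $$ (b,a) * R J (b,a))"
        by (simp only: sum_subtractf)
      finally have "(\<Sum>k\<in>I. cnj (r k J0) * r k J) = (\<Sum>p<dA. \<Sum>q<dA. Y0 $$ (q,p) * T J (p,q)) - mtrace Y0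
        + ((\<Sum>b<dB. \<Sum>a<dB. H $$ (b,a) * \<sigma> $$ (b,a)) - (\<Sum>b<dB. \<Sum>a<dB. H $$ (b,a) * R J (b,a)))" .
      hence "Re (mtrace (?J J * ?M)) = Re (\<Sum>k\<in>I. cnj (r k J0) * r k J) - F"
        unfolding split by (simp add: \<beta>_def h_def)
      thus ?thesis using sep[OF J] by simp
    qed
    with pos have "psd (dB*dA) (A.RX.tw ?M)"
      by (intro A.RX.psd_twI[OF Mc M_herm, of "real dA"]) auto
    moreover have "Re (mtrace Y) < h" using trY F by simp
    ultimately show thesis
      using that(2)[OF Yc Hc Y_herm H_herm] by (simp only: h_def)
  qed
qed

text \<open>A separating pair perturbs the maximally mixed state in the direction of H to a reference state
  that violates the inequality between the conditional entropies.\<close>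

lemma witness_violates:
  assumes \<rho>: "density dA \<rho>" and \<sigma>: "density dB \<sigma>" and pos: "dB > 0" and "\<delta> > 0"
    and Y: "Y \<in> carrier_mat dA dA" and H: "H \<in> carrier_mat dB dB"
    and herm: "\<And>i j. i < dB \<Longrightarrow> j < dB \<Longrightarrow> H $$ (j,i) = cnj (H $$ (i,j))"
    and lt: "Re (mtrace Y) < Re (\<Sum>b<dB. \<Sum>a<dB. H $$ (b,a) * \<sigma> $$ (b,a))"
    and psd: "psd (dB*dA) (A.RX.tw (kron (1\<^sub>m dB) Y - kron H \<rho>))"
  obtains \<eta> where "density dB \<eta>"
    "\<forall>i<dB. \<forall>j<dB. cmod (\<eta> $$ (i,j) - ((1 / of_nat dB) \<cdot>\<^sub>m 1\<^sub>m dB) $$ (i,j)) < \<delta>"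
    "A.mval \<eta> \<rho> < B.mval \<eta> \<sigma>"
proof -
  have \<rho>c: "\<rho> \<in> carrier_mat dA dA" "psd dA \<rho>" "mtrace \<rho> = 1" and \<sigma>c: "\<sigma> \<in> carrier_mat dB dB" "mtrace \<sigma> = 1"
    using \<rho> \<sigma> by (auto simp: density_def psd_iff)
  define C where "C = (\<Sum>i<dB. \<Sum>j<dB. cmod (H $$ (i,j)))"
  define h where "h = Re (mtrace H)"
  have C0: "C \<ge> 0" by (simp add: C_def sum_nonneg)
  have row: "cmod (H $$ (i,j)) \<le> (\<Sum>j<dB. cmod (H $$ (i,j)))" if "j < dB" for i j
    using that by (intro member_le_sum[of j "{..<dB}" "\<lambda>j. cmod (H $$ (i,j))"]) auto
  have entry: "cmod (H $$ (i,j)) \<le> C" if "i < dB" "j < dB" for i j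
  proof -
    have "(\<Sum>j<dB. cmod (H $$ (i,j))) \<le> C"
      unfolding C_def using that(1)
      by (intro member_le_sum[of i "{..<dB}" "\<lambda>i. \<Sum>j<dB. cmod (H $$ (i,j))"]) (auto simp: sum_nonneg)
    thus ?thesis using row[OF that(2), of i] by linarith
  qed
  have "cmod (mtrace H) \<le> (\<Sum>i<dB. cmod (H $$ (i,i)))"
    unfolding mtrace_carrier[OF H] by (rule norm_sum)
  also have "\<dots> \<le> C" unfolding C_def by (intro sum_mono row) auto
  finally have hC: "\<bar>h\<bar> \<le> C" unfolding h_def using abs_Re_le_cmod order_trans by blast
  have "Im (H $$ (i,i)) = 0" if "i < dB" for i
    using herm[OF that that] by (simp add: complex_eq_iff)
  hence trH: "mtrace H = of_real h"
    by (simp add: h_def complex_eq_iff mtrace_carrier[OF H])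
  define \<epsilon> where "\<epsilon> = min (1 / (C * dB + C + 1)) (\<delta> / (2 * C + 1))"
  have den: "0 < C * dB + C + 1" "0 < 2 * C + 1" using C0 by (auto intro: add_nonneg_pos)
  have \<epsilon>: "0 < \<epsilon>" "\<epsilon> \<le> 1 / (C * dB + C + 1)" "\<epsilon> \<le> \<delta> / (2 * C + 1)"
    using den \<open>\<delta> > 0\<close> by (auto simp: \<epsilon>_def)
  have \<epsilon>1: "\<epsilon> * (C * dB + C) \<le> 1"
  proof -
    have "\<epsilon> * (C * dB + C + 1) \<le> 1" using \<epsilon>(2) den by (simp add: field_simps)
    thus ?thesis using \<epsilon>(1) by (simp add: algebra_simps)
  qed
  have \<epsilon>2: "\<epsilon> * (2 * C) < \<delta>"
  proof -
    have "\<epsilon> * (2 * C + 1) \<le> \<delta>" using \<epsilon>(3) den by (simp add: field_simps)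
    thus ?thesis using \<epsilon>(1) by (simp add: algebra_simps)
  qed
  define s where "s = (1 - \<epsilon> * h) / dB"
  have sd: "s * dB + \<epsilon> * h = 1" using pos by (simp add: s_def)
  have "\<epsilon> * h \<le> \<epsilon> * C" using hC \<epsilon>(1) by (intro mult_left_mono) auto
  hence "\<epsilon> * C * dB \<le> 1 - \<epsilon> * h" using \<epsilon>1 by (simp add: algebra_simps)
  hence s: "\<epsilon> * C \<le> s" using pos by (simp add: s_def field_simps)
  hence s0: "0 \<le> s" using C0 \<epsilon>(1) by (meson less_imp_le mult_nonneg_nonneg order_trans)
  define \<eta> where "\<eta> = of_real s \<cdot>\<^sub>m 1\<^sub>m dB + of_real \<epsilon> \<cdot>\<^sub>m H"
  have \<eta>c: "\<eta> \<in> carrier_mat dB dB" using H by (simp add: \<eta>_def)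
  have "psd dB \<eta>"
    unfolding \<eta>_def
  proof (rule psd_diag_dominant)
    fix i j assume ij: "i < dB" "j < dB"
    show "(of_real \<epsilon> \<cdot>\<^sub>m H) $$ (j,i) = cnj ((of_real \<epsilon> \<cdot>\<^sub>m H) $$ (i,j))"
      using herm[OF ij] ij H by simp
  next
    have "(\<Sum>i<dB. \<Sum>j<dB. cmod ((of_real \<epsilon> \<cdot>\<^sub>m H) $$ (i,j))) = \<epsilon> * C"
      unfolding C_def sum_distrib_left using H \<epsilon>(1) by (intro sum.cong refl) (simp add: norm_mult)
    thus "(\<Sum>i<dB. \<Sum>j<dB. cmod ((of_real \<epsilon> \<cdot>\<^sub>m H) $$ (i,j))) \<le> s" using s by simp
  qed (use H in simp)
  moreover have "mtrace \<eta> = of_real (s * dB + \<epsilon> * h)"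
    using H by (simp add: \<eta>_def mtrace_add[of _ dB] mtrace_smult[of _ dB] mtrace_one trH)
  ultimately have \<eta>: "density dB \<eta>" using sd by (simp add: density_def)
  have close: "cmod (\<eta> $$ (i,j) - ((1 / of_nat dB) \<cdot>\<^sub>m 1\<^sub>m dB) $$ (i,j)) < \<delta>" if ij: "i < dB" "j < dB" for i j
  proof -
    have "s - 1 / dB = - (\<epsilon> * h) / dB" by (simp add: s_def diff_divide_distrib)
    hence "\<bar>s - 1 / dB\<bar> = \<epsilon> * \<bar>h\<bar> / dB" using \<epsilon>(1) by (simp add: abs_mult)
    also have "\<dots> \<le> \<epsilon> * \<bar>h\<bar> / 1" using \<epsilon>(1) pos by (intro divide_left_mono) auto
    also have "\<dots> \<le> \<epsilon> * C" using hC \<epsilon>(1) by simp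
    finally have s1: "\<bar>s - 1 / dB\<bar> \<le> \<epsilon> * C" .
    have "\<eta> $$ (i,j) - ((1 / of_nat dB) \<cdot>\<^sub>m 1\<^sub>m dB) $$ (i,j)
      = of_real (s - 1 / dB) * (if i = j then 1 else 0) + of_real \<epsilon> * H $$ (i,j)"
      using ij H by (simp add: \<eta>_def)
    also have "cmod \<dots> \<le> cmod (of_real (s - 1 / dB) * (if i = j then 1 else 0)) + cmod (of_real \<epsilon> * H $$ (i,j))"
      by (rule norm_triangle_ineq)
    also have "\<dots> \<le> \<bar>s - 1 / dB\<bar> + \<epsilon> * cmod (H $$ (i,j))"
      using \<epsilon>(1) by (intro add_mono) (auto simp: norm_mult simp flip: of_real_diff)
    also have "\<dots> \<le> \<epsilon> * C + \<epsilon> * C" using s1 entry[OF ij] \<epsilon>(1) by (intro add_mono mult_left_mono) auto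
    also have "\<dots> < \<delta>" using \<epsilon>2 by (simp add: mult_ac)
    finally show ?thesis .
  qed
  define Z where "Z = of_real \<epsilon> \<cdot>\<^sub>m Y + of_real s \<cdot>\<^sub>m \<rho>"
  have Zc: "Z \<in> carrier_mat dA dA" using Y \<rho>c by (simp add: Z_def)
  let ?M = "kron (1\<^sub>m dB) Y - kron H \<rho>"
  have Mc: "?M \<in> carrier_mat (dB*dA) (dB*dA)" using Y H \<rho>c by (intro minus_carrier_mat kron_carrier)
  have "kron (1\<^sub>m dB) Z - kron \<eta> \<rho> = of_real \<epsilon> \<cdot>\<^sub>m ?M"
  proof (rule eq_mat_blockI[of _ dB dA])
    fix a p b q assume i: "a < dB" "p < dA" "b < dB" "q < dA"
    have "(kron (1\<^sub>m dB) Z - kron \<eta> \<rho>) $$ (a*dA+p, b*dA+q) = (1\<^sub>m dB) $$ (a,b) * Z $$ (p,q) - \<eta> $$ (a,b) * \<rho> $$ (p,q)"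
      using i Zc \<eta>c \<rho>c carrier_matD[OF kron_carrier[OF \<eta>c \<rho>c(1)]] by (simp add: mult_add_less kron_index[of _ dB _ dA])
    also have "\<dots> = of_real \<epsilon> * ((1\<^sub>m dB) $$ (a,b) * Y $$ (p,q) - H $$ (a,b) * \<rho> $$ (p,q))"
      using i Y H \<rho>c by (simp add: Z_def \<eta>_def algebra_simps)
    also have "\<dots> = (of_real \<epsilon> \<cdot>\<^sub>m ?M) $$ (a*dA+p, b*dA+q)"
      using i Y H \<rho>c carrier_matD[OF kron_carrier[OF H \<rho>c(1)]] by (simp add: mult_add_less kron_index[of _ dB _ dA])
    finally show "(kron (1\<^sub>m dB) Z - kron \<eta> \<rho>) $$ (a*dA+p, b*dA+q) = (of_real \<epsilon> \<cdot>\<^sub>m ?M) $$ (a*dA+p, b*dA+q)" .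
  qed (use Mc \<eta>c \<rho>c in \<open>auto intro!: minus_carrier_mat kron_carrier\<close>)
  hence "A.RX.tw (kron (1\<^sub>m dB) Z - kron \<eta> \<rho>) = of_real \<epsilon> \<cdot>\<^sub>m A.RX.tw ?M"
    by (simp only: A.RX.tw_smult[OF Mc])
  hence eq: "kron (1\<^sub>m dB) (A.X.tw Z) - A.RX.tw (kron \<eta> \<rho>) = of_real \<epsilon> \<cdot>\<^sub>m A.RX.tw ?M"
    using Zc \<eta>c \<rho>c by (simp add: A.RX.tw_minus A.tw_kron_one)
  have psd1: "psd (dB*dA) (kron (1\<^sub>m dB) (A.X.tw Z) - A.RX.tw (kron \<eta> \<rho>))"
    unfolding eq using psd \<epsilon>(1) by (intro psd_smult) auto
  have psd2: "psd (dB*dA) (A.RX.tw (kron \<eta> \<rho>))"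
    using \<eta> \<rho>c by (intro A.RX.psd_tw psd_kron) (auto simp: density_def)
  have "kron (1\<^sub>m dB) (A.X.tw Z) - A.RX.tw (kron \<eta> \<rho>) + A.RX.tw (kron \<eta> \<rho>) = kron (1\<^sub>m dB) (A.X.tw Z)"
    by (intro eq_matI) (auto simp: carrier_matD[OF kron_carrier[OF one_carrier_mat A.X.tw_carrier]]
        carrier_matD[OF A.RX.tw_carrier])
  with psd_add[OF psd1 psd2] have "psd (dB*dA) (kron (1\<^sub>m dB) (A.X.tw Z))" by simp
  hence psdZ: "psd dA (A.X.tw Z)" using pos by (rule psd_kron_one_cancel[OF _ A.X.tw_carrier])
  have trZ: "Re (mtrace (A.X.tw Z)) = \<epsilon> * Re (mtrace Y) + s"
    using Y \<rho>c by (simp add: A.X.mtrace_tw Zc) (simp add: Z_def mtrace_add[of _ dA] mtrace_smult[of _ dA])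
  have "Re (mtrace (A.X.tw Z)) \<in> feas dB dA (A.RX.tw (kron \<eta> \<rho>))"
    unfolding feas_def using psdZ psd1 by blast
  hence "A.mval \<eta> \<rho> \<le> Re (mtrace (A.X.tw Z))"
    by (intro cInf_lower A.feas_bdd_below \<eta> \<rho> pos)
  also have "\<dots> < \<epsilon> * Re (\<Sum>b<dB. \<Sum>a<dB. H $$ (b,a) * \<sigma> $$ (b,a)) + s"
    using lt \<epsilon>(1) by (simp add: trZ)
  also have "\<dots> = Re (\<Sum>b<dB. \<Sum>a<dB. \<eta> $$ (b,a) * \<sigma> $$ (b,a))"
  proof -
    have "(\<Sum>b<dB. \<Sum>a<dB. \<eta> $$ (b,a) * \<sigma> $$ (b,a))
      = (\<Sum>b<dB. \<Sum>a<dB. of_real \<epsilon> * (H $$ (b,a) * \<sigma> $$ (b,a)) + (if a = b then of_real s * \<sigma> $$ (b,a) else 0))"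
      using H by (intro sum.cong refl) (auto simp: \<eta>_def algebra_simps)
    also have "\<dots> = of_real \<epsilon> * (\<Sum>b<dB. \<Sum>a<dB. H $$ (b,a) * \<sigma> $$ (b,a)) + of_real s * mtrace \<sigma>"
      using \<sigma>c(1) by (simp add: sum.distrib mtrace_carrier sum_distrib_left)
    finally show ?thesis using \<sigma>c(2) by simp
  qed
  also have "\<dots> \<le> B.mval \<eta> \<sigma>"
    by (intro B.mval_entangled_bound \<eta> \<sigma> refl)
  finally show thesis using that \<eta> close by blast
qed

end

theorem theorem4:
  fixes gmul :: "'g::t2_space \<Rightarrow> 'g \<Rightarrow> 'g" and e :: 'g and ginv :: "'g \<Rightarrow> 'g"
    and \<mu> :: "'g measure"
    and dA dB :: nat and UA UB :: "'g \<Rightarrow> complex mat"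
    and \<rho> \<sigma> :: "complex mat"
  assumes "compact_group gmul e ginv"
    and "haar gmul \<mu>"
    and "unitary_rep gmul dA UA"
    and "unitary_rep gmul dB UB"
    and "density dA \<rho>"
    and "density dB \<sigma>"
  shows "(\<exists>E. channel dA dB E \<and> covariant dA UA UB E \<and> E \<rho> = \<sigma>) \<longleftrightarrow>
         local_min_states dB
           (\<lambda>\<eta>. Heta \<mu> (\<lambda>g. cconj_mat (UB g)) dB UB dB \<eta> \<sigma>
                - Heta \<mu> (\<lambda>g. cconj_mat (UB g)) dB UA dA \<eta> \<rho>)
           ((1 / of_nat dB) \<cdot>\<^sub>m 1\<^sub>m dB)"
proof -
  interpret two_reps gmul e ginv \<mu> dA dB UA UB
    using assms by unfold_locales
  have pos: "dA > 0" "dB > 0"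
    using assms(5,6) by (auto simp: density_def psd_def mtrace_def intro!: gr0I)
  let ?f = "\<lambda>\<eta>. - log 2 (B.mval \<eta> \<sigma>) - - log 2 (A.mval \<eta> \<rho>)"
  let ?\<eta>0 = "(1 / of_nat dB) \<cdot>\<^sub>m 1\<^sub>m dB"
  have f0: "?f ?\<eta>0 = 0"
    by (simp only: A.mval_mixed[OF assms(5) pos(2)] B.mval_mixed[OF assms(6) pos(2)])
  have f_iff: "0 \<le> ?f \<eta> \<longleftrightarrow> B.mval \<eta> \<sigma> \<le> A.mval \<eta> \<rho>" if "density dB \<eta>" for \<eta>
    using A.mval_pos[OF that assms(5) pos(2)] B.mval_pos[OF that assms(6) pos(2)] by simp
  have "(\<exists>E. channel dA dB E \<and> covariant dA UA UB E \<and> E \<rho> = \<sigma>) \<longleftrightarrow> local_min_states dB ?f ?\<eta>0"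
  proof
    assume "\<exists>E. channel dA dB E \<and> covariant dA UA UB E \<and> E \<rho> = \<sigma>"
    then obtain E where E: "channel dA dB E" "covariant dA UA UB E" "E \<rho> = \<sigma>" by blast
    have "?f ?\<eta>0 \<le> ?f \<eta>" if \<eta>: "density dB \<eta>" for \<eta>
      using mval_mono[OF E(1,2) \<eta> assms(5) _ pos(2)] assms(6) f_iff[OF \<eta>] unfolding f0 E(3) by blast
    thus "local_min_states dB ?f ?\<eta>0"
      unfolding local_min_states_def by (intro exI[of _ 1]) auto
  next
    assume "local_min_states dB ?f ?\<eta>0"
    then obtain \<delta> where \<delta>: "\<delta> > 0" "\<And>\<eta>. density dB \<eta> \<Longrightarrow>
        \<forall>i<dB. \<forall>j<dB. cmod (\<eta> $$ (i,j) - ?\<eta>0 $$ (i,j)) < \<delta> \<Longrightarrow> ?f ?\<eta>0 \<le> ?f \<eta>"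
      unfolding local_min_states_def by blast
    show "\<exists>E. channel dA dB E \<and> covariant dA UA UB E \<and> E \<rho> = \<sigma>"
    proof (rule covariant_channel_or_witness[OF assms(5,6) pos])
      fix Y H
      assume Y: "Y \<in> carrier_mat dA dA" and H: "H \<in> carrier_mat dB dB"
        and herm: "\<And>i j. i < dB \<Longrightarrow> j < dB \<Longrightarrow> H $$ (j,i) = cnj (H $$ (i,j))"
        and lt: "Re (mtrace Y) < Re (\<Sum>b<dB. \<Sum>a<dB. H $$ (b,a) * \<sigma> $$ (b,a))"
        and psd: "psd (dB*dA) (A.RX.tw (kron (1\<^sub>m dB) Y - kron H \<rho>))"
      obtain \<eta> where \<eta>: "density dB \<eta>" "\<forall>i<dB. \<forall>j<dB. cmod (\<eta> $$ (i,j) - ?\<eta>0 $$ (i,j)) < \<delta>"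
        "A.mval \<eta> \<rho> < B.mval \<eta> \<sigma>"
        using witness_violates[OF assms(5,6) pos(2) \<delta>(1) Y H herm lt psd] by blast
      have "0 \<le> ?f \<eta>" using \<delta>(2)[OF \<eta>(1,2)] unfolding f0 .
      thus ?thesis using \<eta>(3) unfolding f_iff[OF \<eta>(1)] by simp
    qed blast
  qed
  thus ?thesis by (simp only: A.Heta_mval B.Heta_mval)
qed

end
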